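(* Let $p$ be a prime and let $A \subseteq \mathbb{Z}_p \setminus \{0\}$ be a subset with $|A| = k \leq 10$ such that the sum of all elements of $A$ is nonzero in $\mathbb{Z}_p$. Then there is an ordering $(a_1,\ldots,a_k)$ of the elements of $A$ whose partial sums $s_0,s_1,\ldots,s_k$ are pairwise distinct, i.e. $s_i \neq s_j$ for all $0 \leq i < j \leq k$.
   Context: For an ordering $(a_1,\ldots,a_k)$ of the elements of a subset $A$ of an abelian group with $|A|=k$, the partial sums are $s_0 = 0$ and $s_j = \sum_{i=1}^j a_i$ for $1 \leq j \leq k$. $\mathbb{Z}_p$ denotes the cyclic group (field) of integers modulo $p$. *)

theory Defs
  imports "HOL-Number_Theory.Residues"
begin

text \<open>An ordering \<open>(a 1, \<dots>, a k)\<close> is indexed from 1; values of \<open>a\<close> outside \<open>{1..k}\<close> are irrelevant.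
  Abelian groups are written additively, as the additive part of a ring record.\<close>

definition is_ordering :: "nat \<Rightarrow> (nat \<Rightarrow> 'a) \<Rightarrow> 'a set \<Rightarrow> bool" where
  "is_ordering k a A \<longleftrightarrow> bij_betw a {1..k} A"

definition partial_sum :: "('a, 'm) ring_scheme \<Rightarrow> (nat \<Rightarrow> 'a) \<Rightarrow> nat \<Rightarrow> 'a" where
  "partial_sum G a j = (\<Oplus>\<^bsub>G\<^esub>i\<in>{1..j}. a i)"

text \<open>The field of integers modulo \<open>p\<close>, with carrier the residues \<open>{0..p - 1}\<close>.\<close>

abbreviation Z_mod :: "nat \<Rightarrow> int ring" where
  "Z_mod p \<equiv> residue_ring (int p)"

end

theory Submission
  imports Defs "HOL-Computational_Algebra.Polynomial" "HOL-Library.Sublist"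
begin

text \<open>Polynomial method. Put \<open>n = k - 1\<close> and \<open>S = \<Sum>A\<close>, and let \<open>V\<close> denote the Vandermonde determinant.
  If every ordering fails, then \<open>V(s_1, \<dots>, s_n) * (\<Prod>j. s_j * (S - s_j))\<close> vanishes modulo \<open>p\<close> at all
  injective tuples \<open>(x_1, \<dots>, x_n)\<close> over \<open>A\<close>. As a polynomial it is divisible by \<open>x_1 \<cdots> x_n\<close>, which is
  invertible modulo \<open>p\<close>. The quotient times \<open>V(x_1, \<dots>, x_n)\<close> has degree \<open>n\<^sup>2\<close> and vanishes on all of
  \<open>A^n\<close>, so by the Combinatorial Nullstellensatz its coefficient at \<open>(x_1 \<cdots> x_n)^n\<close>, an integer
  independent of \<open>A\<close> and \<open>p\<close>, is divisible by \<open>p\<close>. Replacing the factor \<open>S - s_n\<close> by \<open>x_n\<close> gives a second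
  such integer. For \<open>k \<le> 10\<close> the greatest common divisor of the two has no prime factor exceeding 3.
  Each coefficient is a sum over pairs of permutations of exponents, evaluated by dynamic programming
  over pairs of sets of exponents.\<close>

hide_const (open) up_ring.coeff up_ring.monom module.smult

section \<open>Laplace expansion\<close>

text \<open>The signed sum over all ways to pick an entry from a list and leave the others.\<close>

primrec laplace :: "('a \<Rightarrow> 'a list \<Rightarrow> int) \<Rightarrow> 'a list \<Rightarrow> int" where
  "laplace F [] = 0"
| "laplace F (e # E) = F e E - laplace (\<lambda>e' E'. F e' (e # E')) E"

text \<open>One induction serves both equality and congruence modulo \<open>p\<close>. The premises
  on \<open>mset\<close> and \<open>subseq\<close> later give access to label sums and to trie
  lookups, respectively.\<close>

lemma laplace_cong_rel:
  assumes "\<And>e E'. mset E = add_mset e (mset E') \<Longrightarrow> subseq E' E \<Longrightarrow> R (F e E') (G e E')"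
    and "R 0 0" and "\<And>a b c d. R a b \<Longrightarrow> R c d \<Longrightarrow> R (a - c) (b - d)"
  shows "R (laplace F E) (laplace G E)"
  using assms(1)
proof (induction E arbitrary: F G)
  case Nil
  then show ?case using assms(2) by simp
next
  case (Cons x E)
  have "R (F x E) (G x E)"
    by (rule Cons.prems) auto
  moreover have "R (laplace (\<lambda>e' E'. F e' (x # E')) E) (laplace (\<lambda>e' E'. G e' (x # E')) E)"
    by (rule Cons.IH, rule Cons.prems) (auto simp: add_mset_commute)
  ultimately show ?case using assms(3) by simp
qed

lemma laplace_cong:
  assumes "\<And>e E'. mset E = add_mset e (mset E') \<Longrightarrow> subseq E' E \<Longrightarrow> F e E' = G e E'"
  shows "laplace F E = laplace G E"
  by (rule laplace_cong_rel[where R = "(=)"]) (use assms in auto)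

lemma laplace_cong_mod:
  assumes "\<And>e E'. mset E = add_mset e (mset E') \<Longrightarrow> subseq E' E \<Longrightarrow> [F e E' = G e E'] (mod p)"
  shows "[laplace F E = laplace G E] (mod p)"
  by (rule laplace_cong_rel[where R = "\<lambda>a b. [a = b] (mod p)"]) (use assms in \<open>auto intro: cong_diff\<close>)

lemma laplace_zero [simp]: "laplace (\<lambda>_ _. 0) E = 0"
  by (induction E) auto

lemma laplace_diff: "laplace (\<lambda>e E'. F e E' - G e E') E = laplace F E - laplace G E"
  by (induction E arbitrary: F G) auto

lemma laplace_add: "laplace (\<lambda>e E'. F e E' + G e E') E = laplace F E + laplace G E"
  by (induction E arbitrary: F G) auto

lemma laplace_mult_left: "laplace (\<lambda>e E'. c * F e E') E = c * laplace F E"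
  by (induction E arbitrary: F) (auto simp: algebra_simps)

lemma laplace_sum: "finite I \<Longrightarrow> laplace (\<lambda>e E'. \<Sum>i\<in>I. F i e E') E = (\<Sum>i\<in>I. laplace (F i) E)"
  by (induction I rule: finite_induct) (auto simp: laplace_add)

text \<open>The picks involving \<open>x\<close> form two single expansions of opposite sign, which
  exchanging the arguments swaps; the other picks are the induction hypothesis with \<open>x\<close>
  put back.\<close>

lemma laplace_laplace_antisym:
  "laplace (\<lambda>e E'. laplace (G e) E') E = - laplace (\<lambda>e E'. laplace (\<lambda>f. G f e) E') E"
proof (induction E arbitrary: G)
  case (Cons x E)
  from Cons.IH[of "\<lambda>e f E''. G e f (x # E'')"] show ?case
    by (simp add: laplace_diff)
qed auto

text \<open>For lists of equal length this is the determinant of the matrix \<open>q s e\<close>,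
  expanded along its rows. Antisymmetry in the rows holds for any \<open>E\<close>, so lengths are
  not enforced.\<close>

primrec alternant :: "('b \<Rightarrow> 'a \<Rightarrow> int) \<Rightarrow> 'b list \<Rightarrow> 'a list \<Rightarrow> int" where
  "alternant q [] E = 1"
| "alternant q (s # ss) E = laplace (\<lambda>e E'. q s e * alternant q ss E') E"

lemma alternant_swap: "alternant q (s # t # ss) E = - alternant q (t # s # ss) E"
proof -
  have "alternant q (s # t # ss) E = laplace (\<lambda>e. laplace (\<lambda>f E''. q s e * q t f * alternant q ss E'')) E"
    by (simp add: laplace_mult_left[symmetric] algebra_simps)
  also have "\<dots> = - laplace (\<lambda>e. laplace (\<lambda>f E''. q s f * q t e * alternant q ss E'')) E"
    by (rule laplace_laplace_antisym)
  also have "\<dots> = - alternant q (t # s # ss) E"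
    by (simp add: laplace_mult_left[symmetric] algebra_simps)
  finally show ?thesis .
qed

text \<open>Exchanging the first two rows either fixes the list, so that the value equals its own
  negative, or reduces to minors that still repeat a row.\<close>

lemma alternant_repeated_head:
  assumes "s \<in> set ss"
  shows "alternant q (s # ss) E = 0"
  using assms
proof (induction ss arbitrary: E)
  case (Cons t ss)
  show ?case
  proof (cases "s = t")
    case True
    then show ?thesis using alternant_swap[of q s s ss E] by simp
  next
    case False
    with Cons have "alternant q (s # ss) E' = 0" for E'
      by simp
    then have "alternant q (t # s # ss) E = 0"
      by simp
    then show ?thesis using alternant_swap[of q s t ss E] by (simp del: alternant.simps)
  qed
qed simp

lemma alternant_not_distinct: "\<not> distinct ss \<Longrightarrow> alternant q ss E = 0"
proof (induction ss arbitrary: E)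
  case (Cons s ss)
  show ?case
  proof (cases "s \<in> set ss")
    case True
    then show ?thesis by (rule alternant_repeated_head)
  next
    case False
    with Cons show ?thesis by simp
  qed
qed simp

lemma alternant_cong_map:
  assumes "\<And>s e. s \<in> set ss \<Longrightarrow> [q s e = q (h s) e] (mod p)"
  shows "[alternant q ss E = alternant q (map h ss) E] (mod p)"
  using assms by (induction ss arbitrary: E) (auto intro!: laplace_cong_mod cong_mult)

lemma alternant_zero_row:
  assumes "s \<in> set ss" and "\<And>e. [q s e = 0] (mod p)"
  shows "[alternant q ss E = 0] (mod p)"
  using assms(1)
proof (induction ss arbitrary: E)
  case (Cons t ss)
  have "[q t e * alternant q ss E' = 0] (mod p)" for e E'
  proof (cases "s = t")
    case True
    then show ?thesis using cong_mult[OF assms(2)[of e] cong_refl[of "alternant q ss E'"]] by simp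
  next
    case False
    then have "[alternant q ss E' = 0] (mod p)"
      using Cons by simp
    then show ?thesis using cong_mult[OF cong_refl[of "q t e"]] by fastforce
  qed
  then have "[laplace (\<lambda>e E'. q t e * alternant q ss E') E = laplace (\<lambda>_ _. 0) E] (mod p)"
    by (intro laplace_cong_mod)
  then show ?case by simp
qed simp

section \<open>The quotient by the product of the variables\<close>

text \<open>The Hasse derivative, i.e. the \<open>m\<close>-th derivative divided by
  \<open>m!\<close>. With it Taylor coefficients stay integral.\<close>

definition hasse :: "nat \<Rightarrow> int poly \<Rightarrow> int poly" where
  "hasse m p = (\<Sum>i\<le>degree p. monom (of_nat (i choose m) * coeff p i) (i - m))"

lemma coeff_hasse: "coeff (hasse m p) j = of_nat ((j + m) choose m) * coeff p (j + m)"
proof -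
  have "coeff (hasse m p) j = (\<Sum>i\<le>degree p. if i = j + m then of_nat (i choose m) * coeff p i else 0)"
    unfolding hasse_def coeff_sum coeff_monom
    by (intro sum.cong refl) (auto simp: binomial_eq_0 not_le)
  also have "\<dots> = of_nat ((j + m) choose m) * coeff p (j + m)"
    by (auto simp: coeff_eq_0 not_le)
  finally show ?thesis .
qed

lemma hasse_0: "hasse 0 p = p"
  by (simp add: poly_eq_iff coeff_hasse)

lemma poly_add_hasse: "poly p (x + s) = (\<Sum>m\<le>degree p. x ^ m * poly (hasse m p) s)"
proof -
  have "poly p (x + s) = (\<Sum>i\<le>degree p. coeff p i * (x + s) ^ i)"
    by (rule poly_altdef)
  also have "\<dots> = (\<Sum>i\<le>degree p. \<Sum>m\<le>degree p. of_nat (i choose m) * coeff p i * x ^ m * s ^ (i - m))"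
  proof (intro sum.cong refl)
    fix i assume "i \<in> {..degree p}"
    have "(x + s) ^ i = (\<Sum>m\<le>i. of_nat (i choose m) * x ^ m * s ^ (i - m))"
      by (rule binomial_ring)
    also have "\<dots> = (\<Sum>m\<le>degree p. of_nat (i choose m) * x ^ m * s ^ (i - m))"
      using \<open>i \<in> _\<close> by (intro sum.mono_neutral_left) (auto simp: binomial_eq_0)
    finally show "coeff p i * (x + s) ^ i = (\<Sum>m\<le>degree p. of_nat (i choose m) * coeff p i * x ^ m * s ^ (i - m))"
      by (simp add: sum_distrib_left algebra_simps)
  qed
  also have "\<dots> = (\<Sum>m\<le>degree p. \<Sum>i\<le>degree p. of_nat (i choose m) * coeff p i * x ^ m * s ^ (i - m))"
    by (rule sum.swap)
  also have "\<dots> = (\<Sum>m\<le>degree p. x ^ m * poly (hasse m p) s)"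
    by (simp add: hasse_def poly_sum poly_monom sum_distrib_left algebra_simps)
  finally show ?thesis .
qed

lemma degree_hasse_le:
  assumes "degree p \<le> d"
  shows "degree (hasse m p) \<le> d - m"
  by (rule degree_le) (use assms in \<open>auto simp: coeff_hasse coeff_eq_0\<close>)

text \<open>Tuples are listed as \<open>x_n, \<dots>, x_1\<close>, so the partial sums are suffix sums.\<close>

primrec suffix_sums :: "int list \<Rightarrow> int list" where
  "suffix_sums [] = []"
| "suffix_sums (x # xs) = sum_list (x # xs) # suffix_sums xs"

text \<open>The label \<open>l \<ge> 2\<close> is the degree in \<open>s\<close>. The factor \<open>s\<close> is split off because of the truncated
  subtraction: the row vanishes at \<open>s = 0\<close> for every \<open>l\<close>.\<close>

definition row :: "int \<Rightarrow> int \<Rightarrow> nat \<Rightarrow> int" where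
  "row S s l = s ^ (l - 2) * s * (S - s)"

definition row_poly :: "int \<Rightarrow> nat \<Rightarrow> int poly" where
  "row_poly S l = monom 1 (l - 2) * [:0, 1:] * [:S, - 1:]"

lemma poly_row_poly [simp]: "poly (row_poly S l) s = row S s l"
  by (simp add: row_poly_def row_def poly_monom algebra_simps)

text \<open>For these labels \<open>row_poly S l\<close> is \<open>X^(l-1) * (S - X)\<close>, so
  \<open>S\<close> enters only below the top degree. This is why the final coefficients do not
  depend on \<open>A\<close>.\<close>

lemma
  assumes "2 \<le> l"
  shows coeff_mult_row_poly: "degree u \<le> R \<Longrightarrow> coeff (u * row_poly S l) (R + l) = - coeff u R"
    and degree_mult_row_poly: "degree u \<le> R \<Longrightarrow> degree (u * row_poly S l) \<le> R + l"
proof -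
  obtain k where l: "l = k + 2"
    using assms by (metis add.commute le_Suc_ex)
  have e: "u * row_poly S l = monom 1 (l - 1) * (smult S u - pCons 0 u)"
    by (simp add: row_poly_def l monom_Suc algebra_simps)
  assume d: "degree u \<le> R"
  show "coeff (u * row_poly S l) (R + l) = - coeff u R"
    unfolding e using d by (simp add: l coeff_monom_mult coeff_eq_0)
  show "degree (u * row_poly S l) \<le> R + l"
    unfolding e using d
    by (intro degree_le allI impI) (auto simp: l coeff_monom_mult coeff_eq_0 coeff_pCons split: nat.split)
qed

text \<open>In the Taylor expansion in \<open>x\<close> the terms \<open>m = 0\<close> add up to a determinant with two equal rows.
  Omitting them makes the division by \<open>x\<close> possible.\<close>

primrec alt_quot :: "int \<Rightarrow> int list \<Rightarrow> int poly \<Rightarrow> nat list \<Rightarrow> int" where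
  "alt_quot S [] u E = poly u 0"
| "alt_quot S (x # xs) u E = laplace (\<lambda>l E'. \<Sum>m\<in>{1..degree (u * row_poly S l)}.
     x ^ (m - 1) * alt_quot S xs (hasse m (u * row_poly S l)) E') E"

lemma alternant_suffix_sums_repeat: "laplace (\<lambda>l E'. row S (sum_list xs) l * alternant (row S) (suffix_sums xs) E') E = 0"
proof (cases xs)
  case Nil
  \<comment> \<open>The empty sum is 0, where \<open>row\<close> vanishes thanks to its separate
    factor \<open>s\<close>.\<close>
  then show ?thesis by (simp add: row_def)
next
  case (Cons x ys)
  then have "laplace (\<lambda>l E'. row S (sum_list xs) l * alternant (row S) (suffix_sums xs) E') E = alternant (row S) (sum_list xs # suffix_sums xs) E"
    by simp
  \<comment> \<open>\<open>sum_list xs\<close> is itself the first suffix sum, so two rows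
    agree.\<close>
  also have "\<dots> = 0"
    by (rule alternant_repeated_head) (simp add: Cons)
  finally show ?thesis .
qed

text \<open>One variable is divided out per step. The Taylor coefficients in the head variable are
  polynomials in the sum of the remaining ones; \<open>u\<close> passes them on, hence the
  generalisation over \<open>u\<close>.\<close>

lemma alternant_suffix_sums_eq_alt_quot:
  "poly u (sum_list xs) * alternant (row S) (suffix_sums xs) E = prod_list xs * alt_quot S xs u E"
proof (induction xs arbitrary: u E)
  case (Cons x xs)
  define s where "s = sum_list xs"
  define p where "p l = u * row_poly S l" for l
  have split: "{..d} = insert 0 {1..d}" for d :: nat
    by auto
  have "poly u (sum_list (x # xs)) * alternant (row S) (suffix_sums (x # xs)) E =
      laplace (\<lambda>l E'. poly (p l) (x + s) * alternant (row S) (suffix_sums xs) E') E"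
    by (simp add: laplace_mult_left[symmetric] p_def s_def mult.assoc)
  also have "\<dots> = laplace (\<lambda>l E'. \<Sum>m\<le>degree (p l). x ^ m * (poly (hasse m (p l)) s * alternant (row S) (suffix_sums xs) E')) E"
    by (simp add: poly_add_hasse sum_distrib_right mult.assoc)
  also have "\<dots> = laplace (\<lambda>l E'. poly u s * (row S s l * alternant (row S) (suffix_sums xs) E') +
      (\<Sum>m\<in>{1..degree (p l)}. x ^ m * (poly (hasse m (p l)) s * alternant (row S) (suffix_sums xs) E'))) E"
    by (simp add: split hasse_0 p_def mult.assoc)
  also have "\<dots> = laplace (\<lambda>l E'. \<Sum>m\<in>{1..degree (p l)}. x ^ m * (poly (hasse m (p l)) s * alternant (row S) (suffix_sums xs) E')) E"
    using alternant_suffix_sums_repeat[of S xs E] by (simp add: laplace_add laplace_mult_left s_def)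
  \<comment> \<open>Only positive powers of \<open>x\<close> remain, so one factor \<open>x\<close>
    joins the product from the induction hypothesis.\<close>
  also have "\<dots> = laplace (\<lambda>l E'. prod_list (x # xs) * (\<Sum>m\<in>{1..degree (p l)}. x ^ (m - 1) * alt_quot S xs (hasse m (p l)) E')) E"
    unfolding s_def Cons.IH sum_distrib_left
    by (intro laplace_cong sum.cong refl) (auto simp: power_eq_if)
  also have "\<dots> = prod_list (x # xs) * alt_quot S (x # xs) u E"
    by (simp add: laplace_mult_left p_def)
  finally show ?case .
qed simp

section \<open>The Nullstellensatz functional\<close>

text \<open>The \<open>t\<close>-fold tensor power of the functional summing
  \<open>w x * f x\<close> over \<open>A\<close>. With divided difference weights it extracts,
  modulo \<open>p\<close>, the coefficient at \<open>(x_1 ... x_t)^n\<close> of polynomials of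
  degree at most \<open>t * n\<close>.\<close>

primrec grid :: "int set \<Rightarrow> (int \<Rightarrow> int) \<Rightarrow> nat \<Rightarrow> (int list \<Rightarrow> int) \<Rightarrow> int" where
  "grid A w 0 F = F []"
| "grid A w (Suc t) F = (\<Sum>x\<in>A. w x * grid A w t (\<lambda>xs. F (x # xs)))"

lemma grid_mult_left: "grid A w t (\<lambda>xs. c * F xs) = c * grid A w t F"
  by (induction t arbitrary: F) (simp_all add: sum_distrib_left algebra_simps)

lemma grid_sum: "grid A w t (\<lambda>xs. \<Sum>i\<in>I. F i xs) = (\<Sum>i\<in>I. grid A w t (F i))"
  by (induction t arbitrary: F) (simp_all add: sum_distrib_left sum.swap[of _ I A])

lemma grid_laplace: "finite A \<Longrightarrow> grid A w t (\<lambda>xs. laplace (F xs) E) = laplace (\<lambda>e E'. grid A w t (\<lambda>xs. F xs e E')) E"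
  by (induction t arbitrary: F) (simp_all add: laplace_sum laplace_mult_left)

lemma grid_dvd:
  assumes "\<And>xs. set xs \<subseteq> A \<Longrightarrow> length xs = t \<Longrightarrow> p dvd F xs"
  shows "p dvd grid A w t F"
  using assms
proof (induction t arbitrary: F)
  case (Suc t)
  have "p dvd grid A w t (\<lambda>xs. F (x # xs))" if "x \<in> A" for x
    by (rule Suc.IH) (use that Suc.prems in auto)
  then show ?case by (auto intro: dvd_sum)
qed simp

text \<open>The labels in \<open>E\<close> are degrees in the partial sums, those in \<open>M\<close> are the complements \<open>n + 1 - e\<close> of the
  exponents \<open>e\<close> of the Vandermonde determinant in the variables.\<close>

primrec laplace_coeff :: "nat \<Rightarrow> nat list \<Rightarrow> nat list \<Rightarrow> int" where
  "laplace_coeff 0 E M = (if E = [] \<and> M = [] then 1 else 0)"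
| "laplace_coeff (Suc t) E M = laplace (\<lambda>l E'. laplace (\<lambda>m M'.
     of_nat ((sum_list M - sum_list E') choose m) * laplace_coeff t E' M') M) E"

text \<open>The integer obtained after replacing \<open>S - s_n\<close> by \<open>x_n\<close>: the
  first row is then \<open>s^(l-1)\<close> and its variable is not divided out, which lowers both
  arguments of the binomial by one.\<close>

definition laplace_coeff_last :: "nat \<Rightarrow> nat list \<Rightarrow> nat list \<Rightarrow> int" where
  "laplace_coeff_last t E M = laplace (\<lambda>l E'. laplace (\<lambda>m M'. of_nat ((l - 1) choose (m - 1)) * laplace_coeff t E' M') M) E"

text \<open>The complement makes \<open>m\<close> the surviving Taylor index:
  \<open>n + 1 - m + (k - 1) = n\<close> exactly for \<open>k = m\<close>. For the labels 2, ..., n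
  + 1 the alternant is the Vandermonde determinant up to sign.\<close>

definition power_row :: "nat \<Rightarrow> int \<Rightarrow> nat \<Rightarrow> int" where
  "power_row n x m = x ^ (n + 1 - m)"

lemma laplace_mset:
  fixes E :: "nat list"
  assumes "mset E = add_mset e (mset E')"
  shows "sum_list E = e + sum_list E'" "length E = Suc (length E')" "set E = insert e (set E')"
proof -
  have "sum_mset (mset E) = sum_mset (add_mset e (mset E'))" "size (mset E) = size (add_mset e (mset E'))"
    "set_mset (mset E) = set_mset (add_mset e (mset E'))"
    unfolding assms by (rule refl)+
  then show "sum_list E = e + sum_list E'" "length E = Suc (length E')" "set E = insert e (set E')"
    by (simp_all add: sum_mset_sum_list)
qed

text \<open>The head variable is not divided out, so the Taylor sum starts at \<open>k = 0\<close>
  without lowering the power of \<open>x\<close>; the remaining variables are treated by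
  \<open>alt_quot\<close>.\<close>

primrec alt_quot_last :: "int \<Rightarrow> int list \<Rightarrow> nat list \<Rightarrow> int" where
  "alt_quot_last S [] E = 0"
| "alt_quot_last S (x # xs) E = laplace (\<lambda>l E'. \<Sum>k\<in>{..l - 1}. x ^ k * alt_quot S xs (hasse k (monom 1 (l - 1))) E') E"

text \<open>The weights of a divided difference, \<open>w a = (\<Prod>b\<in>A - {a}. 1 / (a - b))\<close> modulo \<open>p\<close>.\<close>

locale divided_difference =
  fixes A :: "int set" and w :: "int \<Rightarrow> int" and n :: nat and p :: int
  assumes fin: "finite A"
    and moment_less: "j < n \<Longrightarrow> [(\<Sum>x\<in>A. w x * x ^ j) = 0] (mod p)"
    and moment_eq: "[(\<Sum>x\<in>A. w x * x ^ n) = 1] (mod p)"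
begin

definition functional :: "int \<Rightarrow> nat \<Rightarrow> int poly \<Rightarrow> nat list \<Rightarrow> nat list \<Rightarrow> int" where
  "functional S t u E M = grid A w t (\<lambda>xs. alternant (power_row n) xs M * alt_quot S xs u E)"

text \<open>Both determinants are expanded along the row of the first variable, whose summation over
  \<open>A\<close> then yields a moment. \<open>I\<close>, \<open>c\<close> and \<open>u\<close>
  stay open to cover both \<open>alt_quot\<close> and \<open>alt_quot_last\<close>.\<close>

lemma grid_step:
  "grid A w (Suc t) (\<lambda>xs. alternant (power_row n) xs M *
      laplace (\<lambda>l E'. \<Sum>k\<in>I l. hd xs ^ c k * alt_quot S (tl xs) (u l k) E') E) =
   laplace (\<lambda>l E'. laplace (\<lambda>m M'. \<Sum>k\<in>I l. (\<Sum>x\<in>A. w x * x ^ (n + 1 - m + c k)) * functional S t (u l k) E' M') M) E"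
proof -
  have "alternant (power_row n) (x # xs) M * laplace (\<lambda>l E'. \<Sum>k\<in>I l. x ^ c k * alt_quot S xs (u l k) E') E =
     laplace (\<lambda>l E'. laplace (\<lambda>m M'. \<Sum>k\<in>I l. x ^ (n + 1 - m + c k) * (alternant (power_row n) xs M' * alt_quot S xs (u l k) E')) M) E" for x xs
  proof -
    have "laplace (\<lambda>m M'. \<Sum>k\<in>I l. x ^ (n + 1 - m + c k) * (alternant (power_row n) xs M' * alt_quot S xs (u l k) E')) M =
       alternant (power_row n) (x # xs) M * (\<Sum>k\<in>I l. x ^ c k * alt_quot S xs (u l k) E')" (is "laplace ?F M = _ * ?Q") for l E'
    proof -
      have "laplace ?F M = laplace (\<lambda>m M'. ?Q * (power_row n x m * alternant (power_row n) xs M')) M"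
        by (intro laplace_cong) (simp add: power_row_def sum_distrib_left sum_distrib_right power_add mult_ac)
      also have "\<dots> = ?Q * laplace (\<lambda>m M'. power_row n x m * alternant (power_row n) xs M') M"
        by (rule laplace_mult_left)
      finally show ?thesis
        by (simp only: alternant.simps mult.commute)
    qed
    then show ?thesis by (simp add: laplace_mult_left)
  qed
  then have "grid A w (Suc t) (\<lambda>xs. alternant (power_row n) xs M *
      laplace (\<lambda>l E'. \<Sum>k\<in>I l. hd xs ^ c k * alt_quot S (tl xs) (u l k) E') E) =
     (\<Sum>x\<in>A. w x * laplace (\<lambda>l E'. laplace (\<lambda>m M'. \<Sum>k\<in>I l. x ^ (n + 1 - m + c k) * functional S t (u l k) E' M') M) E)"
    by (simp add: grid_laplace fin grid_sum grid_mult_left functional_def del: alternant.simps)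
  also have "\<dots> = laplace (\<lambda>l E'. laplace (\<lambda>m M'. \<Sum>x\<in>A. w x * (\<Sum>k\<in>I l. x ^ (n + 1 - m + c k) * functional S t (u l k) E' M')) M) E"
    by (simp add: laplace_sum fin laplace_mult_left)
  also have "\<dots> = laplace (\<lambda>l E'. laplace (\<lambda>m M'. \<Sum>k\<in>I l. (\<Sum>x\<in>A. w x * x ^ (n + 1 - m + c k)) * functional S t (u l k) E' M') M) E"
    by (simp add: sum_distrib_left sum_distrib_right sum.swap[of _ A] mult.assoc)
  finally show ?thesis .
qed

text \<open>Only the term with exponent exactly \<open>n\<close> survives: smaller moments vanish modulo \<open>p\<close>, larger ones
  leave too small a degree behind.\<close>

lemma moment_sum:
  fixes k0 :: nat
  assumes "finite I"
    and less: "\<And>k. k \<in> I \<Longrightarrow> k < k0 \<Longrightarrow> j k < n"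
    and eq: "k0 \<in> I \<Longrightarrow> j k0 = n" "k0 \<in> I \<Longrightarrow> [t k0 = v] (mod p)"
    and greater: "\<And>k. k \<in> I \<Longrightarrow> k > k0 \<Longrightarrow> [t k = 0] (mod p)"
    and out: "k0 \<notin> I \<Longrightarrow> [v = 0] (mod p)"
  shows "[(\<Sum>k\<in>I. (\<Sum>x\<in>A. w x * x ^ j k) * t k) = v] (mod p)"
proof -
  have "[(\<Sum>x\<in>A. w x * x ^ j k) * t k = (if k = k0 then v else 0)] (mod p)" if "k \<in> I" for k
  proof (rule linorder_cases[of k k0])
    assume "k < k0"
    with cong_mult[OF moment_less[OF less[OF that]] cong_refl[of "t k"]] show ?thesis by simp
  next
    assume "k = k0"
    with that cong_mult[OF moment_eq eq(2)] eq(1) show ?thesis by simp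
  next
    assume "k > k0"
    with cong_mult[OF cong_refl greater[OF that]] show ?thesis by force
  qed
  then have "[(\<Sum>k\<in>I. (\<Sum>x\<in>A. w x * x ^ j k) * t k) = (\<Sum>k\<in>I. if k = k0 then v else 0)] (mod p)"
    by (intro cong_sum)
  also have "(\<Sum>k\<in>I. if k = k0 then v else 0) = (if k0 \<in> I then v else 0)"
    using \<open>finite I\<close> by simp
  also have "[\<dots> = v] (mod p)"
    using out by (auto simp: cong_sym)
  finally show ?thesis .
qed

text \<open>The total degree is at most \<open>R + sum_list E - sum_list M + t * n\<close>, so the
  premise bounds it by \<open>t * n\<close>, and only equality can give a nonzero coefficient. Each
  variable contributes -1 from the leading term of its row and a binomial from the Hasse
  derivative.\<close>

lemma functional_cong:
  assumes "length E = t" "length M = t" "degree u \<le> R" "R + sum_list E \<le> sum_list M"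
    and "\<forall>l\<in>set E. 2 \<le> l" "\<forall>m\<in>set M. 1 \<le> m \<and> m \<le> n + 1"
  shows "[functional S t u E M = (if R + sum_list E = sum_list M then (- 1) ^ t * coeff u R * laplace_coeff t E M else 0)] (mod p)"
  using assms
proof (induction t arbitrary: E M u R)
  case 0
  then show ?case by (simp add: functional_def poly_0_coeff_0)
next
  case (Suc t)
  define q where "q l = u * row_poly S l" for l
  define c where "c = (if R + sum_list E = sum_list M then (- 1) ^ Suc t * coeff u R else 0)"
  have "functional S (Suc t) u E M = grid A w (Suc t) (\<lambda>xs. alternant (power_row n) xs M *
      laplace (\<lambda>l E'. \<Sum>k\<in>{1..degree (q l)}. hd xs ^ (k - 1) * alt_quot S (tl xs) (hasse k (q l)) E') E)"
    by (simp add: functional_def q_def)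
  also have "\<dots> = laplace (\<lambda>l E'. laplace (\<lambda>m M'. \<Sum>k\<in>{1..degree (q l)}.
      (\<Sum>x\<in>A. w x * x ^ (n + 1 - m + (k - 1))) * functional S t (hasse k (q l)) E' M') M) E"
    by (rule grid_step)
  also have "[\<dots> = laplace (\<lambda>l E'. laplace (\<lambda>m M'.
      c * (of_nat ((sum_list M - sum_list E') choose m) * laplace_coeff t E' M')) M) E] (mod p)"
  proof (intro laplace_cong_mod)
    fix l E' m M'
    assume "mset E = add_mset l (mset E')" and "mset M = add_mset m (mset M')"
    note E = laplace_mset[OF this(1)] and M = laplace_mset[OF this(2)]
    have l: "2 \<le> l" and m: "1 \<le> m" "m \<le> n + 1"
      using Suc.prems E M by auto
    have deg: "degree (q l) \<le> R + l"
      unfolding q_def by (rule degree_mult_row_poly) (use l Suc.prems in auto)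
    have IH: "[functional S t (hasse k (q l)) E' M' = (if R + l - k + sum_list E' = sum_list M'
        then (- 1) ^ t * coeff (hasse k (q l)) (R + l - k) * laplace_coeff t E' M' else 0)] (mod p)"
      if "R + l - k + sum_list E' \<le> sum_list M'" for k
      by (rule Suc.IH) (use that Suc.prems E M degree_hasse_le[OF deg] in auto)
    show "[(\<Sum>k\<in>{1..degree (q l)}. (\<Sum>x\<in>A. w x * x ^ (n + 1 - m + (k - 1))) * functional S t (hasse k (q l)) E' M') =
        c * (of_nat ((sum_list M - sum_list E') choose m) * laplace_coeff t E' M')] (mod p)" (is "[_ = ?v] (mod p)")
    proof (rule moment_sum[where ?k0.0 = m])
      \<comment> \<open>A larger power of \<open>x\<close> leaves too small a degree for the
        remaining variables.\<close>
      fix k assume "k \<in> {1..degree (q l)}" "m < k"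
      then have "R + l - k + sum_list E' < sum_list M'"
        using deg Suc.prems E M by auto
      then show "[functional S t (hasse k (q l)) E' M' = 0] (mod p)"
        using IH[of k] by simp
    next
      assume "m \<in> {1..degree (q l)}"
      then have le: "m \<le> R + l"
        using deg by simp
      have "coeff (hasse m (q l)) (R + l - m) = - of_nat ((R + l) choose m) * coeff u R"
        using le l Suc.prems by (simp add: coeff_hasse q_def coeff_mult_row_poly)
      moreover have "R + l - m + sum_list E' \<le> sum_list M'"
        using le Suc.prems E M by simp
      moreover have "R + l - m + sum_list E' = sum_list M' \<longleftrightarrow> R + sum_list E = sum_list M"
        using le E M by auto
      \<comment> \<open>In the case of equality the degree \<open>R + l\<close> is determined by the
        labels, which gives the binomial in \<open>laplace_coeff\<close>.\<close>
      moreover have "sum_list M - sum_list E' = R + l" if "R + sum_list E = sum_list M"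
        using that E M by simp
      ultimately show "[functional S t (hasse m (q l)) E' M' = ?v] (mod p)"
        using IH[of m] by (auto simp: c_def algebra_simps)
    next
      assume "m \<notin> {1..degree (q l)}"
      then have less: "degree (q l) < m"
        using m by simp
      \<comment> \<open>The actual degree of \<open>q l\<close> may lie below the bound
        \<open>R + l\<close>: then \<open>coeff u R\<close> is 0. Otherwise the binomial or
        \<open>c\<close> is 0.\<close>
      have "?v = 0"
      proof (cases "R + sum_list E = sum_list M \<and> m \<le> R + l")
        case True
        then have "coeff (q l) (R + l) = 0"
          using less by (intro coeff_eq_0) simp
        then show ?thesis
          using l Suc.prems by (simp add: q_def coeff_mult_row_poly c_def)
      next
        case False
        then show ?thesis using E M by (auto simp: c_def binomial_eq_0)
      qed
      then show "[?v = 0] (mod p)" by (simp only: cong_refl)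
    qed (use m in auto)
  qed
  also have "laplace (\<lambda>l E'. laplace (\<lambda>m M'. c * (of_nat ((sum_list M - sum_list E') choose m) * laplace_coeff t E' M')) M) E =
      c * laplace_coeff (Suc t) E M"
    by (simp add: laplace_mult_left)
  finally show ?case by (simp add: c_def split: if_splits)
qed

text \<open>Only the head variable differs from \<open>functional_cong\<close>: its row is monic, so
  it adds no sign, and its surviving Taylor index is \<open>m - 1\<close>. The other
  \<open>t\<close> variables are left to \<open>functional_cong\<close>.\<close>

lemma grid_alt_quot_last_cong:
  assumes "length E = Suc t" "length M = Suc t" "sum_list E = sum_list M"
    and "\<forall>l\<in>set E. 2 \<le> l" "\<forall>m\<in>set M. 1 \<le> m \<and> m \<le> n + 1"
  shows "[grid A w (Suc t) (\<lambda>xs. alternant (power_row n) xs M * alt_quot_last S xs E) = (- 1) ^ t * laplace_coeff_last t E M] (mod p)"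
proof -
  define q :: "nat \<Rightarrow> int poly" where "q l = monom 1 (l - 1)" for l
  have "grid A w (Suc t) (\<lambda>xs. alternant (power_row n) xs M * alt_quot_last S xs E) = grid A w (Suc t) (\<lambda>xs. alternant (power_row n) xs M *
      laplace (\<lambda>l E'. \<Sum>k\<in>{..l - 1}. hd xs ^ k * alt_quot S (tl xs) (hasse k (q l)) E') E)"
    by (simp add: q_def)
  also have "\<dots> = laplace (\<lambda>l E'. laplace (\<lambda>m M'. \<Sum>k\<in>{..l - 1}.
      (\<Sum>x\<in>A. w x * x ^ (n + 1 - m + k)) * functional S t (hasse k (q l)) E' M') M) E" (is "_ = ?R")
    by (rule grid_step)
  finally have eq: "grid A w (Suc t) (\<lambda>xs. alternant (power_row n) xs M * alt_quot_last S xs E) = ?R" .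
  have "[?R = laplace (\<lambda>l E'. laplace (\<lambda>m M'.
      (- 1) ^ t * (of_nat ((l - 1) choose (m - 1)) * laplace_coeff t E' M')) M) E] (mod p)"
  proof (intro laplace_cong_mod)
    fix l E' m M'
    assume "mset E = add_mset l (mset E')" and "mset M = add_mset m (mset M')"
    note E = laplace_mset[OF this(1)] and M = laplace_mset[OF this(2)]
    have l: "2 \<le> l" and m: "1 \<le> m" "m \<le> n + 1"
      using assms E M by auto
    have deg: "degree (q l) \<le> l - 1"
      by (simp add: q_def degree_monom_eq)
    have IH: "[functional S t (hasse k (q l)) E' M' = (if l - 1 - k + sum_list E' = sum_list M'
        then (- 1) ^ t * coeff (hasse k (q l)) (l - 1 - k) * laplace_coeff t E' M' else 0)] (mod p)"
      if "l - 1 - k + sum_list E' \<le> sum_list M'" for k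
      by (rule functional_cong) (use that assms E M degree_hasse_le[OF deg] in auto)
    show "[(\<Sum>k\<in>{..l - 1}. (\<Sum>x\<in>A. w x * x ^ (n + 1 - m + k)) * functional S t (hasse k (q l)) E' M') =
        (- 1) ^ t * (of_nat ((l - 1) choose (m - 1)) * laplace_coeff t E' M')] (mod p)" (is "[_ = ?v] (mod p)")
    proof (rule moment_sum[where ?k0.0 = "m - 1"])
      fix k assume "k \<in> {..l - 1}" "m - 1 < k"
      then have "l - 1 - k + sum_list E' < sum_list M'"
        using assms E M l by auto
      then show "[functional S t (hasse k (q l)) E' M' = 0] (mod p)"
        using IH[of k] by simp
    next
      assume "m - 1 \<in> {..l - 1}"
      then have le: "m \<le> l"
        using l by simp
      have "coeff (hasse (m - 1) (q l)) (l - 1 - (m - 1)) = of_nat ((l - 1) choose (m - 1))"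
        using le m by (simp add: coeff_hasse q_def)
      moreover have "l - 1 - (m - 1) + sum_list E' = sum_list M'"
        using le m assms E M by simp
      ultimately show "[functional S t (hasse (m - 1) (q l)) E' M' = ?v] (mod p)"
        using IH[of "m - 1"] by (simp add: mult.assoc)
    next
      assume "m - 1 \<notin> {..l - 1}"
      then show "[?v = 0] (mod p)" by (simp add: binomial_eq_0)
    qed (use m in auto)
  qed
  then show ?thesis
    unfolding eq by (simp only: laplace_mult_left laplace_coeff_last_def)
qed

end

lemma alt_quot_last_eq:
  assumes "xs \<noteq> []"
  shows "laplace (\<lambda>l E'. sum_list xs ^ (l - 1) * alternant (row S) (suffix_sums (tl xs)) E') E = prod_list (tl xs) * alt_quot_last S xs E"
proof -
  obtain x ys where xs: "xs = x # ys"
    using assms by (cases xs) auto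
  have "laplace (\<lambda>l E'. sum_list xs ^ (l - 1) * alternant (row S) (suffix_sums ys) E') E =
     laplace (\<lambda>l E'. \<Sum>k\<in>{..l - 1}. x ^ k * (poly (hasse k (monom 1 (l - 1))) (sum_list ys) * alternant (row S) (suffix_sums ys) E')) E"
    using poly_add_hasse[of "monom 1 (l - 1)" x "sum_list ys" for l]
    by (simp add: xs poly_monom degree_monom_eq sum_distrib_right mult.assoc)
  also have "\<dots> = laplace (\<lambda>l E'. prod_list ys * (\<Sum>k\<in>{..l - 1}. x ^ k * alt_quot S ys (hasse k (monom 1 (l - 1))) E')) E"
    unfolding alternant_suffix_sums_eq_alt_quot by (simp add: sum_distrib_left mult.left_commute)
  also have "\<dots> = prod_list ys * alt_quot_last S xs E"
    by (simp only: laplace_mult_left xs alt_quot_last.simps)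
  finally show ?thesis by (simp add: xs)
qed

section \<open>Existence of divided difference weights modulo a prime\<close>

lemma divided_difference_exists:
  fixes A :: "int set" and p :: int
  assumes "prime p" "finite A" "card A = Suc n" "inj_on (\<lambda>a. a mod p) A"
  shows "\<exists>w. divided_difference A w n p"
  using assms(2-)
proof (induction n arbitrary: A)
  case 0
  then obtain a where A: "A = {a}"
    by (auto simp: card_Suc_eq)
  show ?case
    by (intro exI[of _ "\<lambda>_. 1"]) (simp add: A divided_difference_def)
next
  case (Suc n)
  obtain b B where A: "A = insert b B" "b \<notin> B" "card B = Suc n"
    using Suc.prems(2) unfolding card_Suc_eq[of A "Suc n"] by blast
  have fin: "finite B"
    using Suc.prems A by simp
  then obtain w where "divided_difference B w n p"
    using Suc.IH[of B] A Suc.prems by (auto simp: inj_on_insert)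
  then interpret divided_difference B w n p .
  have "\<exists>c. [(a - b) * c = 1] (mod p)" if "a \<in> B" for a
  proof -
    have "\<not> p dvd a - b"
      using that A Suc.prems(3) by (auto simp: inj_on_def mod_eq_dvd_iff)
    with \<open>prime p\<close> have "coprime p (a - b)"
      by (rule prime_imp_coprime)
    then have "coprime (a - b) p"
      by (rule coprime_commute[THEN iffD1])
    then show ?thesis by (rule cong_solve_coprime_int)
  qed
  then obtain i where i: "\<And>a. a \<in> B \<Longrightarrow> [(a - b) * i a = 1] (mod p)"
    by metis
  \<comment> \<open>Adding the node \<open>b\<close> divides each old weight by
    \<open>a - b\<close>; the weight at \<open>b\<close> is chosen to make the moment of order 0
    vanish.\<close>
  define v where "v a = (if a = b then - (\<Sum>a\<in>B. w a * i a) else w a * i a)" for a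
  have vB: "(\<Sum>a\<in>B. v a * f a) = (\<Sum>a\<in>B. w a * i a * f a)" for f
    using A(2) by (intro sum.cong) (auto simp: v_def)
  have sum_v: "(\<Sum>a\<in>A. v a * f a) = v b * f b + (\<Sum>a\<in>B. w a * i a * f a)" for f
    using A fin by (simp add: vB)
  have zero: "(\<Sum>a\<in>A. v a * a ^ 0) = 0"
    unfolding sum_v by (simp add: v_def)
  \<comment> \<open>Writing \<open>a = b + (a - b)\<close> reduces each new moment to the preceding
    one plus an old moment.\<close>
  have step: "[(\<Sum>a\<in>A. v a * a ^ Suc j) = b * (\<Sum>a\<in>A. v a * a ^ j) + (\<Sum>a\<in>B. w a * a ^ j)] (mod p)" for j
  proof -
    have "(\<Sum>a\<in>A. v a * a ^ Suc j) = b * (\<Sum>a\<in>A. v a * a ^ j) + (\<Sum>a\<in>B. ((a - b) * i a) * (w a * a ^ j))"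
      using sum_v[of "\<lambda>a. a ^ Suc j"] sum_v[of "\<lambda>a. a ^ j"]
      by (simp add: sum_distrib_left left_diff_distrib right_diff_distrib distrib_left sum_subtractf mult_ac)
    also have "[\<dots> = b * (\<Sum>a\<in>A. v a * a ^ j) + (\<Sum>a\<in>B. 1 * (w a * a ^ j))] (mod p)"
      by (intro cong_add cong_refl cong_sum cong_mult i)
    finally show ?thesis by simp
  qed
  have less: "[(\<Sum>a\<in>A. v a * a ^ j) = 0] (mod p)" if "j < Suc n" for j
    using that
  proof (induction j)
    case 0
    show ?case by (simp only: zero cong_refl)
  next
    case (Suc j)
    have "[b * (\<Sum>a\<in>A. v a * a ^ j) + (\<Sum>a\<in>B. w a * a ^ j) = b * 0 + 0] (mod p)"
      using Suc by (intro cong_add cong_mult cong_refl moment_less) auto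
    from cong_trans[OF step this] show ?case by simp
  qed
  have "[b * (\<Sum>a\<in>A. v a * a ^ n) + (\<Sum>a\<in>B. w a * a ^ n) = b * 0 + 1] (mod p)"
    by (intro cong_add cong_mult cong_refl less moment_eq) auto
  from cong_trans[OF step this] have "[(\<Sum>a\<in>A. v a * a ^ Suc n) = 1] (mod p)"
    by simp
  with less Suc.prems(1) have "divided_difference A v (Suc n) p"
    by unfold_locales auto
  then show ?case by blast
qed

section \<open>Orderings\<close>

text \<open>As \<open>s_0 = 0\<close> and \<open>s_k = S\<close>, collisions with either end make
  the factor \<open>s * (S - s)\<close> of a row vanish, and the other collisions make two rows
  congruent.\<close>

lemma alternant_row_zero:
  assumes "\<not> distinct (map (\<lambda>s. s mod p) ss) \<or> (\<exists>s\<in>set ss. [s = 0] (mod p) \<or> [s = S] (mod p))"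
  shows "p dvd alternant (row S) ss E"
proof (cases "distinct (map (\<lambda>s. s mod p) ss)")
  case True
  with assms obtain s where s: "s \<in> set ss" "[s = 0] (mod p) \<or> [s = S] (mod p)"
    by blast
  then have "[row S s e = 0] (mod p)" for e
    by (auto simp: row_def cong_iff_dvd_diff dvd_diff_commute[of p s])
  from alternant_zero_row[where q = "row S" and E = E, OF s(1) this] show ?thesis
    by (simp add: cong_0_iff)
next
  case False
  have "[alternant (row S) ss E = alternant (row S) (map (\<lambda>s. s mod p) ss) E] (mod p)"
    by (rule alternant_cong_map) (auto simp: row_def intro!: cong_mult cong_pow cong_diff cong_refl)
  then show ?thesis
    using alternant_not_distinct[OF False, of "row S" E] by (simp add: cong_0_iff)
qed

lemma coefficients_dvd:
  fixes A :: "int set" and p :: int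
  assumes p: "prime p" and A: "A \<subseteq> {1..<p}" "card A = Suc n" and S: "\<not> p dvd \<Sum>A"
    and bad: "\<And>y xs. set (y # xs) = A \<Longrightarrow> distinct (y # xs) \<Longrightarrow> \<not> distinct (map (\<lambda>s. s mod p) (suffix_sums (y # xs) @ [0]))"
    and E: "length E = n" "\<forall>l\<in>set E. 2 \<le> l \<and> l \<le> n + 1"
  shows "p dvd laplace_coeff n E E" and "0 < n \<Longrightarrow> p dvd laplace_coeff_last (n - 1) E E"
proof -
  have fin: "finite A"
    using A(2) card.infinite by fastforce
  have not_dvd: "\<not> p dvd a" if "a \<in> A" for a
    using that A(1) zdvd_not_zless[of a p] by force
  have "inj_on (\<lambda>a. a mod p) A"
  proof (rule inj_onI)
    fix x y assume "x \<in> A" "y \<in> A" and mod: "x mod p = y mod p"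
    with A(1) have "x mod p = x" "y mod p = y"
      by (auto simp: subset_iff)
    with mod show "x = y" by simp
  qed
  then obtain w where "divided_difference A w n p"
    using divided_difference_exists[OF p fin A(2)] by blast
  then interpret divided_difference A w n p .
  \<comment> \<open>An injective tuple leaves out exactly one element \<open>y\<close> of
    \<open>A\<close>, which completes it to an ordering.\<close>
  have key: "p dvd alt_quot (\<Sum>A) xs 1 E \<and> (xs \<noteq> [] \<longrightarrow> p dvd alt_quot_last (\<Sum>A) xs E)"
    if xs: "set xs \<subseteq> A" "length xs = n" "distinct xs" for xs
  proof -
    have "card (A - set xs) = 1"
      using xs A fin by (simp add: card_Diff_subset distinct_card)
    then obtain y where "A - set xs = {y}"
      by (auto simp: card_1_singleton_iff)
    then have y: "set (y # xs) = A" "y \<notin> set xs" "y \<in> A"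
      using xs by auto
    have sum: "\<Sum>A = y + sum_list xs"
      using distinct_sum_list_conv_Sum[OF xs(3)] y(2) unfolding y(1)[symmetric] by simp
    have "\<not> distinct (map (\<lambda>s. s mod p) (suffix_sums (y # xs) @ [0]))"
      using bad[of y xs] y xs by simp
    \<comment> \<open>The sums of \<open>y # xs\<close> are \<open>S\<close>, the suffix sums of
      \<open>xs\<close> and 0. As \<open>S\<close> is nonzero modulo \<open>p\<close>, the collision
      involves a suffix sum of \<open>xs\<close>.\<close>
    then have dvd: "p dvd alternant (row (\<Sum>A)) (suffix_sums xs) E"
      using S by (intro alternant_row_zero) (auto simp: sum[symmetric] cong_def mod_0_imp_dvd)
    have "\<not> p dvd prod_list zs" if "set zs \<subseteq> A" for zs
      using that by (induction zs) (use p not_dvd in \<open>auto simp: prime_dvd_mult_iff\<close>)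
    then have prod: "p dvd g" if "p dvd prod_list zs * g" "set zs \<subseteq> A" for zs g
      using that p by (auto simp: prime_dvd_mult_iff)
    have "p dvd prod_list xs * alt_quot (\<Sum>A) xs 1 E"
      using dvd alternant_suffix_sums_eq_alt_quot[of 1 xs "\<Sum>A" E] by simp
    moreover have "p dvd alt_quot_last (\<Sum>A) xs E" if "xs \<noteq> []"
    proof -
      let ?f = "laplace (\<lambda>l E'. sum_list xs ^ (l - 1) * alternant (row (\<Sum>A)) (suffix_sums (tl xs)) E') E"
      obtain x zs where xz: "xs = x # zs"
        using \<open>xs \<noteq> []\<close> by (cases xs) auto
      have "alternant (row (\<Sum>A)) (suffix_sums xs) E = laplace (\<lambda>l E'. row (\<Sum>A) (sum_list xs) l * alternant (row (\<Sum>A)) (suffix_sums (tl xs)) E') E"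
        by (simp add: xz)
      \<comment> \<open>\<open>S - sum_list xs\<close> is the missing element \<open>y\<close>,
        which is invertible modulo \<open>p\<close> and can be cancelled.\<close>
      also have "\<dots> = laplace (\<lambda>l E'. y * (sum_list xs ^ (l - 1) * alternant (row (\<Sum>A)) (suffix_sums (tl xs)) E')) E"
      proof (intro laplace_cong)
        fix l E' assume "mset E = add_mset l (mset E')"
        then have "2 \<le> l"
          using laplace_mset(3) E(2) by blast
        then obtain k where "l = k + 2"
          by (metis add.commute le_Suc_ex)
        then show "row (\<Sum>A) (sum_list xs) l * alternant (row (\<Sum>A)) (suffix_sums (tl xs)) E' =
            y * (sum_list xs ^ (l - 1) * alternant (row (\<Sum>A)) (suffix_sums (tl xs)) E')"
          by (simp add: row_def sum)
      qed
      also have "\<dots> = y * ?f"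
        by (rule laplace_mult_left)
      finally have "p dvd ?f"
        using dvd p not_dvd[OF y(3)] by (simp add: prime_dvd_mult_iff)
      then show ?thesis
        unfolding alt_quot_last_eq[OF that] by (rule prod) (use xs xz in auto)
    qed
    ultimately show ?thesis
      using prod xs by blast
  qed
  \<comment> \<open>The Vandermonde factor vanishes on the tuples with a repetition, where nothing
    is known about \<open>g\<close>.\<close>
  have van: "p dvd alternant (power_row n) xs E * g" if "distinct xs \<Longrightarrow> p dvd g" for xs g
    using that alternant_not_distinct[of xs "power_row n" E] by (cases "distinct xs") auto
  have "p dvd functional (\<Sum>A) n 1 E E"
    unfolding functional_def by (intro grid_dvd van) (use key in blast)
  moreover have "[functional (\<Sum>A) n 1 E E = (- 1) ^ n * laplace_coeff n E E] (mod p)"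
  proof -
    have "[functional (\<Sum>A) n 1 E E = (if 0 + sum_list E = sum_list E then (- 1) ^ n * coeff 1 0 * laplace_coeff n E E else 0)] (mod p)"
      by (rule functional_cong) (use E in auto)
    then show ?thesis by simp
  qed
  ultimately have "p dvd (- 1) ^ n * laplace_coeff n E E"
    using cong_dvd_iff by blast
  then show "p dvd laplace_coeff n E E"
    by (cases "even n") auto
  assume "0 < n"
  then obtain t where n: "n = Suc t"
    by (cases n) auto
  have "p dvd grid A w (Suc t) (\<lambda>xs. alternant (power_row n) xs E * alt_quot_last (\<Sum>A) xs E)"
  proof (intro grid_dvd van)
    fix xs assume "set xs \<subseteq> A" "length xs = Suc t" "distinct xs"
    moreover from this have "xs \<noteq> []"
      by auto
    ultimately show "p dvd alt_quot_last (\<Sum>A) xs E"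
      using key[of xs] n by blast
  qed
  moreover have "[grid A w (Suc t) (\<lambda>xs. alternant (power_row n) xs E * alt_quot_last (\<Sum>A) xs E) = (- 1) ^ t * laplace_coeff_last t E E] (mod p)"
    by (rule grid_alt_quot_last_cong) (use E n in auto)
  ultimately have "p dvd (- 1) ^ t * laplace_coeff_last t E E"
    using cong_dvd_iff by blast
  then show "p dvd laplace_coeff_last (n - 1) E E"
    unfolding n by (cases "even t") auto
qed

section \<open>From lists of integers to orderings in the residue ring\<close>

lemma length_suffix_sums [simp]: "length (suffix_sums ys) = length ys"
  by (induction ys) auto

lemma suffix_sums_append_nth: "i \<le> length ys \<Longrightarrow> (suffix_sums ys @ [0]) ! i = sum_list (drop i ys)"
proof (induction ys arbitrary: i)
  case (Cons y ys)
  then show ?case by (cases i) simp_all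
qed simp

lemma finsum_residue:
  assumes "prime p" "finite A" "f ` A \<subseteq> {0..<int p}"
  shows "(\<Oplus>\<^bsub>Z_mod p\<^esub>x\<in>A. f x) = (\<Sum>x\<in>A. f x) mod int p"
proof -
  interpret residues "int p" "Z_mod p"
    by unfold_locales (use prime_gt_1_nat[OF assms(1)] in auto)
  have "(\<Oplus>\<^bsub>Z_mod p\<^esub>x\<in>A. f x) = (\<Oplus>\<^bsub>Z_mod p\<^esub>x\<in>A. f x mod int p)"
    using assms(3) by (intro finsum_cong') (auto simp: image_subset_iff)
  then show ?thesis
    using sum_cong[OF assms(2)] by simp
qed

lemma ordering_of_list:
  assumes p: "prime p" and A: "A \<subseteq> {0..<int p}" and ys: "distinct ys" "set ys = A" "length ys = k"
    and sums: "distinct (map (\<lambda>s. s mod int p) (suffix_sums ys @ [0]))"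
  shows "\<exists>a. is_ordering k a A \<and>
    (\<forall>i j. 0 \<le> i \<and> i < j \<and> j \<le> k \<longrightarrow> partial_sum (Z_mod p) a i \<noteq> partial_sum (Z_mod p) a j)"
\<comment> \<open>\<open>ys\<close> lists the ordering from its last element to its first, and
  orderings are indexed from 1.\<close>
proof (intro exI[of _ "\<lambda>i. rev ys ! (i - 1)"] conjI allI impI)
  have "bij_betw (\<lambda>i. i - 1) {1..k} {..<k}"
    by (rule bij_betwI[of _ _ _ Suc]) auto
  moreover have "bij_betw ((!) (rev ys)) {..<k} A"
    by (rule bij_betw_nth) (simp_all add: ys)
  ultimately have "bij_betw (\<lambda>i. rev ys ! (i - 1)) {1..k} A"
    using bij_betw_trans by (fastforce simp: comp_def)
  then show "is_ordering k (\<lambda>i. rev ys ! (i - 1)) A"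
    by (simp add: is_ordering_def)
next
  have prefix: "(\<Sum>i\<in>{1..j}. rev ys ! (i - 1)) = (suffix_sums ys @ [0]) ! (k - j)" if "j \<le> k" for j
  proof -
    have "(\<Sum>i\<in>{1..j}. rev ys ! (i - 1)) = (\<Sum>i<j. rev ys ! i)"
      by (rule sum.reindex_bij_witness[of _ Suc "\<lambda>i. i - 1"]) auto
    also have "\<dots> = sum_list (take j (rev ys))"
      using that ys by (simp add: sum_list_sum_nth atLeast0LessThan)
    also have "\<dots> = sum_list (drop (k - j) ys)"
      using ys by (simp add: take_rev)
    finally show ?thesis
      using suffix_sums_append_nth[of "k - j" ys] ys by simp
  qed
  have partial: "partial_sum (Z_mod p) (\<lambda>i. rev ys ! (i - 1)) j = (suffix_sums ys @ [0]) ! (k - j) mod int p" if "j \<le> k" for j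
  proof -
    have "rev ys ! (i - 1) \<in> A" if "i \<in> {1..j}" for i
      using that \<open>j \<le> k\<close> ys nth_mem[of "i - 1" "rev ys"] by auto
    then have "(\<lambda>i. rev ys ! (i - 1)) ` {1..j} \<subseteq> {0..<int p}"
      using A by blast
    then show ?thesis
      by (simp only: partial_sum_def finsum_residue[OF p finite_atLeastAtMost] prefix[OF \<open>j \<le> k\<close>])
  qed
  fix i j :: nat
  assume "0 \<le> i \<and> i < j \<and> j \<le> k"
  then have ij: "i \<le> k" "j \<le> k" "k - i \<noteq> k - j"
    by auto
  then have "map (\<lambda>s. s mod int p) (suffix_sums ys @ [0]) ! (k - i) \<noteq> map (\<lambda>s. s mod int p) (suffix_sums ys @ [0]) ! (k - j)"
    by (subst nth_eq_iff_index_eq[OF sums]) (auto simp: ys)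
  then show "partial_sum (Z_mod p) (\<lambda>i. rev ys ! (i - 1)) i \<noteq> partial_sum (Z_mod p) (\<lambda>i. rev ys ! (i - 1)) j"
    unfolding partial[OF ij(1)] partial[OF ij(2)] by (simp add: ys del: map_append)
qed

text \<open>Contraposition of \<open>coefficients_dvd\<close>: it suffices that \<open>p\<close>
  misses one of the two integers. For \<open>n = 0\<close> only the first is available.\<close>

lemma ordering_exists:
  assumes "prime p" "A \<subseteq> carrier (Z_mod p) - {\<zero>\<^bsub>Z_mod p\<^esub>}" "card A = Suc n"
    and "(\<Oplus>\<^bsub>Z_mod p\<^esub>x\<in>A. x) \<noteq> \<zero>\<^bsub>Z_mod p\<^esub>"
    and E: "length E = n" "\<forall>l\<in>set E. 2 \<le> l \<and> l \<le> n + 1"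
    and "\<not> (int p dvd laplace_coeff n E E \<and> (0 < n \<longrightarrow> int p dvd laplace_coeff_last (n - 1) E E))"
  shows "\<exists>a. is_ordering (Suc n) a A \<and>
    (\<forall>i j. 0 \<le> i \<and> i < j \<and> j \<le> Suc n \<longrightarrow> partial_sum (Z_mod p) a i \<noteq> partial_sum (Z_mod p) a j)"
proof (rule ccontr)
  assume none: "\<not> ?thesis"
  have p: "prime (int p)"
    using assms(1) by simp
  have fin: "finite A"
    using assms(3) card.infinite by fastforce
  have A: "A \<subseteq> {1..<int p}"
    using assms(2) by (auto simp: residue_ring_def)
  then have A0: "A \<subseteq> {0..<int p}"
    by force
  have S: "\<not> int p dvd \<Sum>A"
  proof -
    have "(\<Oplus>\<^bsub>Z_mod p\<^esub>x\<in>A. x) = \<Sum>A mod int p"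
      by (rule finsum_residue) (use assms(1) fin A0 in auto)
    then have "\<Sum>A mod int p \<noteq> \<zero>\<^bsub>Z_mod p\<^esub>"
      using assms(4) by (rule subst)
    then show ?thesis
      by (simp add: residue_ring_def dvd_eq_mod_eq_0)
  qed
  have bad: "\<not> distinct (map (\<lambda>s. s mod int p) (suffix_sums (y # xs) @ [0]))" if "set (y # xs) = A" "distinct (y # xs)" for y xs
  proof
    assume distinct: "distinct (map (\<lambda>s. s mod int p) (suffix_sums (y # xs) @ [0]))"
    have "length (y # xs) = Suc n"
      using distinct_card[OF that(2)] that(1) assms(3) by simp
    from ordering_of_list[OF assms(1) A0 that(2,1) this distinct] none show False
      by blast
  qed
  show False
    using coefficients_dvd[OF p A assms(3) S bad E] assms(7) by blast
qed

section \<open>Evaluation by tries\<close>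

text \<open>A trie tabulates a function of two subsets of a list of labels: a \<open>Row\<close> node branches on whether
  its label belongs to the first subset (right branch) or not, a \<open>Col\<close> node does so for the second.\<close>

datatype trie = Zero | Leaf int | Row int trie trie | Col int trie trie

text \<open>Prunes subtries that are zero throughout, which keeps the tables sparse.\<close>

fun row_node :: "int \<Rightarrow> trie \<Rightarrow> trie \<Rightarrow> trie" where
  "row_node e Zero Zero = Zero"
| "row_node e l r = Row e l r"

fun col_node :: "int \<Rightarrow> trie \<Rightarrow> trie \<Rightarrow> trie" where
  "col_node e Zero Zero = Zero"
| "col_node e l r = Col e l r"

definition leaf :: "int \<Rightarrow> trie" where
  "leaf v = (if v = 0 then Zero else Leaf v)"

fun neg :: "trie \<Rightarrow> trie" where
  "neg Zero = Zero"
| "neg (Leaf v) = leaf (- v)"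
| "neg (Row e l r) = row_node e (neg l) (neg r)"
| "neg (Col e l r) = col_node e (neg l) (neg r)"

text \<open>The last clause is a default that tries of a common \<open>shape\<close> never
  reach.\<close>

fun sub :: "trie \<Rightarrow> trie \<Rightarrow> trie" where
  "sub t Zero = t"
| "sub Zero t = neg t"
| "sub (Leaf a) (Leaf b) = leaf (a - b)"
| "sub (Row e l r) (Row f l' r') = row_node e (sub l l') (sub r r')"
| "sub (Col e l r) (Col f l' r') = col_node e (sub l l') (sub r r')"
| "sub _ _ = Zero"

text \<open>For positive \<open>m\<close> the value 0 at negative \<open>r\<close> agrees with the
  truncated subtraction in \<open>laplace_coeff\<close>.\<close>

definition bin :: "int \<Rightarrow> int \<Rightarrow> int" where
  "bin r m = (if r < 0 then 0 else of_nat (nat r choose nat m))"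

text \<open>The flag chooses between the binomials of \<open>laplace_coeff\<close> and of
  \<open>laplace_coeff_last\<close>.\<close>

fun weight :: "bool \<Rightarrow> int \<Rightarrow> int \<Rightarrow> int" where
  "weight False r m = bin r m"
| "weight True r m = bin (r - 1) (m - 1)"

text \<open>The parameter \<open>r\<close> accumulates the sum of the chosen column labels minus that of the row labels.\<close>

fun scale :: "bool \<Rightarrow> int \<Rightarrow> int \<Rightarrow> trie \<Rightarrow> trie" where
  "scale b m r Zero = Zero"
| "scale b m r (Leaf v) = leaf (weight b r m * v)"
| "scale b m r (Row e l k) = Zero"
| "scale b m r (Col e l k) = col_node e (scale b m r l) (scale b m (r + e) k)"

text \<open>The inner expansion for all pairs of subsets at once: picking \<open>e\<close> leaves a
  set without \<open>e\<close>, found in the left subtrie; keeping \<open>e\<close> continues in the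
  right one with opposite sign.\<close>

fun wedge_col :: "bool \<Rightarrow> int \<Rightarrow> trie \<Rightarrow> trie" where
  "wedge_col b r Zero = Zero"
| "wedge_col b r (Leaf v) = Zero"
| "wedge_col b r (Row e l k) = row_node e (wedge_col b r l) (wedge_col b (r - e) k)"
| "wedge_col b r (Col e l k) = col_node e (wedge_col b r l) (sub (scale b e (r + e) l) (wedge_col b (r + e) k))"

fun wedge_row :: "trie \<Rightarrow> trie" where
  "wedge_row Zero = Zero"
| "wedge_row (Leaf v) = Zero"
| "wedge_row (Row e l k) = row_node e (wedge_row l) (sub l (wedge_row k))"
| "wedge_row (Col e l k) = Zero"

definition step :: "bool \<Rightarrow> trie \<Rightarrow> trie" where
  "step b t = wedge_row (wedge_col b 0 t)"

fun full :: "trie \<Rightarrow> int" where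
  "full Zero = 0"
| "full (Leaf v) = v"
| "full (Row e l k) = full k"
| "full (Col e l k) = full k"

text \<open>Matching on \<open>Row\<close> has the trie evaluated before it is duplicated. The other
  values are defaults.\<close>

fun finish :: "trie \<Rightarrow> int \<times> int" where
  "finish Zero = (0, 0)"
| "finish (Leaf v) = (0, 0)"
| "finish (Row e l k) = (full (step False (Row e l k)), full (step True (Row e l k)))"
| "finish (Col e l k) = (0, 0)"

text \<open>The only nonzero value belongs to the empty subsets, as in
  \<open>laplace_coeff 0\<close>.\<close>

primrec unit_col :: "nat list \<Rightarrow> trie" where
  "unit_col [] = Leaf Numeral1"
| "unit_col (m # ms) = col_node (int m) (unit_col ms) Zero"

primrec unit_row :: "nat list \<Rightarrow> trie \<Rightarrow> trie" where
  "unit_row [] t = t"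
| "unit_row (e # es) t = row_node (int e) (unit_row es t) Zero"

fun val :: "trie \<Rightarrow> nat list \<Rightarrow> nat list \<Rightarrow> int" where
  "val Zero E M = 0"
| "val (Leaf v) E M = (if E = [] \<and> M = [] then v else 0)"
| "val (Row e l k) E M = (if E \<noteq> [] \<and> int (hd E) = e then val k (tl E) M else val l E M)"
| "val (Col e l k) E M = (if M \<noteq> [] \<and> int (hd M) = e then val k E (tl M) else val l E M)"

text \<open>Row labels lie above column labels, both in list order; \<open>Zero\<close> may stand
  for any pruned subtrie.\<close>

fun shape :: "nat list \<Rightarrow> nat list \<Rightarrow> trie \<Rightarrow> bool" where
  "shape es ms Zero \<longleftrightarrow> True"
| "shape es ms (Leaf v) \<longleftrightarrow> es = [] \<and> ms = []"
| "shape es ms (Row e l k) \<longleftrightarrow> es \<noteq> [] \<and> e = int (hd es) \<and> shape (tl es) ms l \<and> shape (tl es) ms k"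
| "shape es ms (Col e l k) \<longleftrightarrow> es = [] \<and> ms \<noteq> [] \<and> e = int (hd ms) \<and> shape es (tl ms) l \<and> shape es (tl ms) k"

section \<open>Correctness of the trie operations\<close>

lemma val_row_node [simp]: "val (row_node e l k) = val (Row e l k)"
  by (cases "(e, l, k)" rule: row_node.cases) (auto simp: fun_eq_iff)

lemma val_col_node [simp]: "val (col_node e l k) = val (Col e l k)"
  by (cases "(e, l, k)" rule: col_node.cases) (auto simp: fun_eq_iff)

lemma val_leaf [simp]: "val (leaf v) = val (Leaf v)"
  by (auto simp: leaf_def fun_eq_iff)

lemma shape_row_node: "shape es ms (Row e l k) \<Longrightarrow> shape es ms (row_node e l k)"
  by (cases "(e, l, k)" rule: row_node.cases) auto

lemma shape_col_node: "shape es ms (Col e l k) \<Longrightarrow> shape es ms (col_node e l k)"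
  by (cases "(e, l, k)" rule: col_node.cases) auto

lemma shape_leaf: "shape es ms (Leaf v) \<Longrightarrow> shape es ms (leaf v)"
  by (simp add: leaf_def)

lemmas shape_node = shape_row_node shape_col_node shape_leaf

lemma neg: "val (neg t) E M = - val t E M" "shape es ms t \<Longrightarrow> shape es ms (neg t)"
  by (induction t arbitrary: E M es ms) (auto intro!: shape_node)

lemma sub:
  assumes "shape es ms t" "shape es ms t'"
  shows "val (sub t t') E M = val t E M - val t' E M \<and> shape es ms (sub t t')"
  using assms
  by (induction t t' arbitrary: E M es ms rule: sub.induct) (auto simp: neg intro!: shape_node)

lemma scale:
  assumes "shape [] ms t"
  shows "val (scale b m r t) E M = weight b (r + sum_list M) m * val t E M \<and> shape [] ms (scale b m r t)"
  using assms
proof (induction t arbitrary: M ms r)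
  case (Col e l k)
  then show ?case
    by (cases M) (auto simp: algebra_simps intro!: shape_node)
qed (auto intro!: shape_node)

lemma subseq_Nil [simp]: "subseq X [] \<longleftrightarrow> X = []"
  by (cases X) auto

lemma subseq_set: "subseq X xs \<Longrightarrow> set X \<subseteq> set xs"
  by (auto dest: list_emb_set)

lemma val_not_hd:
  assumes "subseq X xs" "x \<notin> set xs"
  shows "val (Row (int x) l k) X M = val l X M" "val (Col (int x) l k) E X = val l E X"
proof -
  have "set X \<subseteq> set xs"
    using assms(1) by (rule subseq_set)
  with assms(2) show "val (Row (int x) l k) X M = val l X M" "val (Col (int x) l k) E X = val l E X"
    by (cases X; auto)+
qed

lemma subseq_Cons_cases:
  assumes "subseq X (x # xs)"
  obtains Y where "X = x # Y" "subseq Y xs" | "subseq X xs"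
  using assms by (cases X) (auto split: if_splits)

text \<open>Treats the part below all row nodes, where \<open>scale\<close> supplies the term that
  picks the head label.\<close>

lemma wedge_col_Col:
  assumes "shape [] ms t" "distinct ms"
  shows "shape [] ms (wedge_col b r t) \<and> (subseq M ms \<longrightarrow> val (wedge_col b r t) E M =
      laplace (\<lambda>m M'. weight b (r + int (sum_list M)) (int m) * val t E M') M)"
  using assms
proof (induction t arbitrary: ms M r)
  case (Col e l k)
  then obtain x xs where ms: "ms = x # xs" and e: "e = int x" and x: "x \<notin> set xs"
    and shapes: "shape [] xs l" "shape [] xs k" "distinct xs"
    by (cases ms) auto
  note IH = Col.IH(1)[OF shapes(1,3)] Col.IH(2)[OF shapes(2,3)]
  note sc = scale[OF shapes(1)]
  have sb: "shape [] xs (sub (scale b (int x) (r + int x) l) (wedge_col b (r + int x) k))"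
    "val (sub (scale b (int x) (r + int x) l) (wedge_col b (r + int x) k)) E M =
      val (scale b (int x) (r + int x) l) E M - val (wedge_col b (r + int x) k) E M" for M
    using sub[of "[]" xs] sc IH by blast+
  have "val (wedge_col b r (Col e l k)) E M =
      laplace (\<lambda>m M'. weight b (r + int (sum_list M)) (int m) * val (Col e l k) E M') M" if "subseq M ms"
    using that unfolding ms
  proof (cases rule: subseq_Cons_cases)
    case (1 Y)
    then show ?thesis
      using IH(2)[of "r + int x" Y] sc[of b "int x" "r + int x" E Y] val_not_hd(2)[OF 1(2) x, of l k E]
      by (simp add: e sb algebra_simps)
  next
    case 2
    have "laplace (\<lambda>m M'. weight b (r + int (sum_list M)) (int m) * val (Col (int x) l k) E M') M =
        laplace (\<lambda>m M'. weight b (r + int (sum_list M)) (int m) * val l E M') M"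
    proof (intro laplace_cong)
      fix m M' assume "subseq M' M"
      then have "subseq M' xs"
        using 2 by (rule subseq_order.order_trans)
      then show "weight b (r + int (sum_list M)) (int m) * val (Col (int x) l k) E M' =
          weight b (r + int (sum_list M)) (int m) * val l E M'"
        using val_not_hd(2)[OF _ x] by simp
    qed
    then show ?thesis
      using IH(1)[of r M] 2 val_not_hd(2)[OF 2 x] by (simp add: e)
  qed
  then show ?case
    using IH sb by (auto simp: ms e intro!: shape_col_node)
qed auto

lemma wedge_col:
  assumes "shape es ms t" "distinct es" "distinct ms" "subseq E es" "subseq M ms"
  shows "shape es ms (wedge_col b r t) \<and> val (wedge_col b r t) E M =
      laplace (\<lambda>m M'. weight b (r + int (sum_list M) - int (sum_list E)) (int m) * val t E M') M"
  using assms
proof (induction t arbitrary: es E r)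
  case (Leaf v)
  then show ?case by simp
next
  case (Row e l k)
  then obtain x xs where es: "es = x # xs" and e: "e = int x" and x: "x \<notin> set xs"
    and shapes: "shape xs ms l" "shape xs ms k" "distinct xs"
    by (cases es) auto
  note IH = Row.IH(1)[OF shapes(1,3) Row.prems(3) _ Row.prems(5)] Row.IH(2)[OF shapes(2,3) Row.prems(3) _ Row.prems(5)]
  have shape: "shape es ms (wedge_col b r (Row e l k))"
    using IH[of "[]"] by (auto simp: es e intro!: shape_row_node)
  from Row.prems(4)[unfolded es] show ?case
  proof (cases rule: subseq_Cons_cases)
    case (1 Y)
    then show ?thesis
      using shape IH(2)[of Y "r - e"] by (simp add: es e algebra_simps)
  next
    case 2
    then show ?thesis
      using shape IH(1)[of E r] val_not_hd(1)[OF 2 x] by (simp add: es e)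
  qed
next
  case (Col e l k)
  then have nil: "es = []" "E = []" and shape: "shape [] ms (Col e l k)"
    by auto
  show ?case
    unfolding nil using wedge_col_Col[OF shape Col.prems(3), of b r M "[]"] Col.prems(5)
    by (simp only: sum_list.Nil of_nat_0 diff_zero simp_thms)
qed simp

lemma wedge_row:
  assumes "shape es ms t" "distinct es" "subseq E es"
  shows "shape es ms (wedge_row t) \<and> val (wedge_row t) E M = laplace (\<lambda>l E'. val t E' M) E"
  using assms
proof (induction t arbitrary: es E)
  case (Row e l k)
  then obtain x xs where es: "es = x # xs" and e: "e = int x" and x: "x \<notin> set xs"
    and shapes: "shape xs ms l" "shape xs ms k" "distinct xs"
    by (cases es) auto
  note IH = Row.IH(1)[OF shapes(1,3)] Row.IH(2)[OF shapes(2,3)]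
  have sb: "shape xs ms (sub l (wedge_row k))"
    "val (sub l (wedge_row k)) E M = val l E M - val (wedge_row k) E M" for E
    using sub[of xs ms] shapes IH(2)[of "[]"] by auto
  have shape: "shape es ms (wedge_row (Row e l k))"
    using IH(1)[of "[]"] sb by (auto simp: es e intro!: shape_row_node)
  from Row.prems(3)[unfolded es] show ?case
  proof (cases rule: subseq_Cons_cases)
    case (1 Y)
    then show ?thesis
      using shape IH(2)[of Y] val_not_hd(1)[OF 1(2) x, of l k M] by (simp add: es e sb)
  next
    case 2
    have "laplace (\<lambda>_ E'. val (Row (int x) l k) E' M) E = laplace (\<lambda>_ E'. val l E' M) E"
    proof (intro laplace_cong)
      fix y :: nat and E' assume "subseq E' E"
      then have "subseq E' xs"
        using 2 by (rule subseq_order.order_trans)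
      then show "val (Row (int x) l k) E' M = val l E' M"
        by (rule val_not_hd(1)) (rule x)
    qed
    then show ?thesis
      using shape IH(1)[of E] 2 val_not_hd(1)[OF 2 x] by (simp add: es e)
  qed
qed auto

lemma step:
  assumes "shape es es t" "distinct es" "subseq E es" "subseq M es"
  shows "shape es es (step b t) \<and> val (step b t) E M =
    laplace (\<lambda>l E'. laplace (\<lambda>m M'. weight b (int (sum_list M) - int (sum_list E')) (int m) * val t E' M') M) E"
proof -
  have col: "shape es es (wedge_col b 0 t)"
    using wedge_col[of es es t "[]" "[]"] assms by simp
  have "laplace (\<lambda>l E'. val (wedge_col b 0 t) E' M) E =
    laplace (\<lambda>l E'. laplace (\<lambda>m M'. weight b (int (sum_list M) - int (sum_list E')) (int m) * val t E' M') M) E"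
  proof (intro laplace_cong)
    fix y :: nat and E' assume "subseq E' E"
    then have "subseq E' es"
      using assms(3) by (rule subseq_order.order_trans)
    then show "val (wedge_col b 0 t) E' M =
        laplace (\<lambda>m M'. weight b (int (sum_list M) - int (sum_list E')) (int m) * val t E' M') M"
      using wedge_col[OF assms(1,2,2) _ assms(4), of E' b 0] by simp
  qed
  then show ?thesis
    using wedge_row[OF col assms(2,3)] by (simp add: step_def)
qed

lemma full: "shape es ms t \<Longrightarrow> full t = val t es ms"
  by (induction t arbitrary: es ms) auto

section \<open>Tries as tables of Laplace coefficients\<close>

lemma bin_diff: "0 < m \<Longrightarrow> bin (int a - int b) (int m) = of_nat ((a - b) choose m)"
  by (auto simp: bin_def binomial_eq_0 nat_diff_distrib)

definition represents :: "nat list \<Rightarrow> nat \<Rightarrow> trie \<Rightarrow> bool" where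
  "represents es k t \<longleftrightarrow> shape es es t \<and> (\<forall>E M. subseq E es \<longrightarrow> subseq M es \<longrightarrow> val t E M = laplace_coeff k E M)"

lemma represents_unit:
  assumes "distinct es"
  shows "represents es 0 (unit_row es (unit_col es))"
proof -
  have Col: "shape [] ms (unit_col ms) \<and> (subseq M ms \<longrightarrow> val (unit_col ms) E M = laplace_coeff 0 E M)" if "distinct ms" for ms M E
    using that
  proof (induction ms arbitrary: M)
    case (Cons m ms)
    have "val (unit_col (m # ms)) E M = laplace_coeff 0 E M" if "subseq M (m # ms)"
      using that
    proof (cases rule: subseq_Cons_cases)
      case 2
      then show ?thesis
        using Cons val_not_hd(2)[OF 2, of m "unit_col ms" Zero E] by simp
    qed simp
    then show ?case
      using Cons by (auto intro!: shape_col_node)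
  qed simp
  have "shape as es (unit_row as (unit_col es)) \<and>
    (subseq E as \<longrightarrow> subseq M es \<longrightarrow> val (unit_row as (unit_col es)) E M = laplace_coeff 0 E M)" if "distinct as" for as E M
    using that
  proof (induction as arbitrary: E)
    case Nil
    then show ?case using Col[OF assms, of M "[]"] by auto
  next
    case (Cons a as)
    have "val (unit_row (a # as) (unit_col es)) E M = laplace_coeff 0 E M" if "subseq E (a # as)" "subseq M es"
      using that(1)
    proof (cases rule: subseq_Cons_cases)
      case 2
      then show ?thesis
        using Cons that(2) val_not_hd(1)[OF 2, of a "unit_row as (unit_col es)" Zero M] by simp
    qed simp
    then show ?case
      using Cons by (auto intro!: shape_row_node)
  qed
  then show ?thesis
    using assms by (simp add: represents_def)
qed

lemma represents_step:
  assumes "represents es k t" "distinct es" "\<forall>e\<in>set es. 0 < e"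
  shows "represents es (Suc k) (step False t)"
proof -
  have t: "shape es es t"
    using assms(1) by (simp add: represents_def)
  have "val (step False t) E M = laplace_coeff (Suc k) E M" if sub: "subseq E es" "subseq M es" for E M
  proof -
    have "val (step False t) E M = laplace (\<lambda>l E'. laplace (\<lambda>m M'.
        weight False (int (sum_list M) - int (sum_list E')) (int m) * val t E' M') M) E"
      using step[OF t assms(2) sub] by simp
    also have "\<dots> = laplace_coeff (Suc k) E M"
      unfolding laplace_coeff.simps
    proof (intro laplace_cong)
      fix l E' m M'
      assume "subseq E' E" "mset M = add_mset m (mset M')" "subseq M' M"
      moreover from this have "m \<in> set es"
        using subseq_set[OF sub(2)] laplace_mset(3)[of M m M'] by simp
      ultimately show "weight False (int (sum_list M) - int (sum_list E')) (int m) * val t E' M' =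
          int (sum_list M - sum_list E' choose m) * laplace_coeff k E' M'"
        using assms sub by (auto simp: represents_def bin_diff intro: subseq_order.order_trans)
    qed
    finally show ?thesis .
  qed
  then show ?thesis
    using step[OF t assms(2), of "[]" "[]"] by (simp add: represents_def)
qed

lemma represents_funpow:
  assumes "distinct es" "\<forall>e\<in>set es. 0 < e"
  shows "represents es k ((step False ^^ k) (unit_row es (unit_col es)))"
  by (induction k) (use assms in \<open>auto intro: represents_unit represents_step\<close>)

text \<open>The premise \<open>c \<noteq> 0\<close> rules out the default values of
  \<open>finish\<close>.\<close>

lemma finish:
  assumes "represents es k t" "distinct es" "\<forall>e\<in>set es. 0 < e" "finish t = (c, d)" "c \<noteq> 0"
  shows "laplace_coeff (Suc k) es es = c" and "laplace_coeff_last k es es = d"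
proof -
  have t: "shape es es t" "\<And>E M. subseq E es \<Longrightarrow> subseq M es \<Longrightarrow> val t E M = laplace_coeff k E M"
    using assms(1) by (auto simp: represents_def)
  have cd: "c = full (step False t)" "d = full (step True t)"
    using assms(4,5) by (cases t; auto)+
  have "laplace_coeff (Suc k) es es = val (step False t) es es"
    using represents_step[OF assms(1-3)] by (simp add: represents_def)
  then show "laplace_coeff (Suc k) es es = c"
    using step[OF t(1) assms(2), of "[]" "[]" False] full[of es es "step False t"] cd(1) by simp
  have "full (step True t) = val (step True t) es es"
    using step[OF t(1) assms(2), of "[]" "[]" True] by (simp add: full)
  also have "\<dots> = laplace (\<lambda>l E'. laplace (\<lambda>m M'. weight True (int (sum_list es) - int (sum_list E')) (int m) * val t E' M') es) es"
    using step[OF t(1) assms(2), of es es True] by simp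
  also have "\<dots> = laplace_coeff_last k es es"
    unfolding laplace_coeff_last_def
  proof (intro laplace_cong)
    fix l E' m M'
    assume sub: "subseq E' es" "subseq M' es" and "mset es = add_mset l (mset E')" "mset es = add_mset m (mset M')"
    note l = laplace_mset[OF this(3)] and m = laplace_mset(3)[OF this(4)]
    have "0 < l" "0 < m"
      using assms(3) l(3) m by blast+
    \<comment> \<open>Both subsets are full, so the difference of the label sums is the removed
      label \<open>l\<close>.\<close>
    then show "weight True (int (sum_list es) - int (sum_list E')) (int m) * val t E' M' =
        int (l - 1 choose (m - 1)) * laplace_coeff k E' M'"
      using t(2)[OF sub] by (simp add: l(1) bin_def nat_diff_distrib of_nat_diff[symmetric])
  qed
  finally show "laplace_coeff_last k es es = d"
    using cd(2) by simp
qed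

text \<open>For labels 2 to 10 the largest difference of label sums is (10+9+8+7+6) - (2+3+4+5) =
  26.\<close>

lemma bin_table:
  "bin Numeral1 2 = 0" "bin Numeral1 3 = 0" "bin Numeral1 4 = 0" "bin Numeral1 5 = 0" "bin Numeral1 6 = 0" "bin Numeral1 7 = 0" "bin Numeral1 8 = 0" "bin Numeral1 9 = 0" "bin Numeral1 10 = 0"
  "bin 2 2 = Numeral1" "bin 2 3 = 0" "bin 2 4 = 0" "bin 2 5 = 0" "bin 2 6 = 0" "bin 2 7 = 0" "bin 2 8 = 0" "bin 2 9 = 0" "bin 2 10 = 0"
  "bin 3 2 = 3" "bin 3 3 = Numeral1" "bin 3 4 = 0" "bin 3 5 = 0" "bin 3 6 = 0" "bin 3 7 = 0" "bin 3 8 = 0" "bin 3 9 = 0" "bin 3 10 = 0"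
  "bin 4 2 = 6" "bin 4 3 = 4" "bin 4 4 = Numeral1" "bin 4 5 = 0" "bin 4 6 = 0" "bin 4 7 = 0" "bin 4 8 = 0" "bin 4 9 = 0" "bin 4 10 = 0"
  "bin 5 2 = 10" "bin 5 3 = 10" "bin 5 4 = 5" "bin 5 5 = Numeral1" "bin 5 6 = 0" "bin 5 7 = 0" "bin 5 8 = 0" "bin 5 9 = 0" "bin 5 10 = 0"
  "bin 6 2 = 15" "bin 6 3 = 20" "bin 6 4 = 15" "bin 6 5 = 6" "bin 6 6 = Numeral1" "bin 6 7 = 0" "bin 6 8 = 0" "bin 6 9 = 0" "bin 6 10 = 0"
  "bin 7 2 = 21" "bin 7 3 = 35" "bin 7 4 = 35" "bin 7 5 = 21" "bin 7 6 = 7" "bin 7 7 = Numeral1" "bin 7 8 = 0" "bin 7 9 = 0" "bin 7 10 = 0"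
  "bin 8 2 = 28" "bin 8 3 = 56" "bin 8 4 = 70" "bin 8 5 = 56" "bin 8 6 = 28" "bin 8 7 = 8" "bin 8 8 = Numeral1" "bin 8 9 = 0" "bin 8 10 = 0"
  "bin 9 2 = 36" "bin 9 3 = 84" "bin 9 4 = 126" "bin 9 5 = 126" "bin 9 6 = 84" "bin 9 7 = 36" "bin 9 8 = 9" "bin 9 9 = Numeral1" "bin 9 10 = 0"
  "bin 10 2 = 45" "bin 10 3 = 120" "bin 10 4 = 210" "bin 10 5 = 252" "bin 10 6 = 210" "bin 10 7 = 120" "bin 10 8 = 45" "bin 10 9 = 10" "bin 10 10 = Numeral1"
  "bin 11 2 = 55" "bin 11 3 = 165" "bin 11 4 = 330" "bin 11 5 = 462" "bin 11 6 = 462" "bin 11 7 = 330" "bin 11 8 = 165" "bin 11 9 = 55" "bin 11 10 = 11"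
  "bin 12 2 = 66" "bin 12 3 = 220" "bin 12 4 = 495" "bin 12 5 = 792" "bin 12 6 = 924" "bin 12 7 = 792" "bin 12 8 = 495" "bin 12 9 = 220" "bin 12 10 = 66"
  "bin 13 2 = 78" "bin 13 3 = 286" "bin 13 4 = 715" "bin 13 5 = 1287" "bin 13 6 = 1716" "bin 13 7 = 1716" "bin 13 8 = 1287" "bin 13 9 = 715" "bin 13 10 = 286"
  "bin 14 2 = 91" "bin 14 3 = 364" "bin 14 4 = 1001" "bin 14 5 = 2002" "bin 14 6 = 3003" "bin 14 7 = 3432" "bin 14 8 = 3003" "bin 14 9 = 2002" "bin 14 10 = 1001"
  "bin 15 2 = 105" "bin 15 3 = 455" "bin 15 4 = 1365" "bin 15 5 = 3003" "bin 15 6 = 5005" "bin 15 7 = 6435" "bin 15 8 = 6435" "bin 15 9 = 5005" "bin 15 10 = 3003"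
  "bin 16 2 = 120" "bin 16 3 = 560" "bin 16 4 = 1820" "bin 16 5 = 4368" "bin 16 6 = 8008" "bin 16 7 = 11440" "bin 16 8 = 12870" "bin 16 9 = 11440" "bin 16 10 = 8008"
  "bin 17 2 = 136" "bin 17 3 = 680" "bin 17 4 = 2380" "bin 17 5 = 6188" "bin 17 6 = 12376" "bin 17 7 = 19448" "bin 17 8 = 24310" "bin 17 9 = 24310" "bin 17 10 = 19448"
  "bin 18 2 = 153" "bin 18 3 = 816" "bin 18 4 = 3060" "bin 18 5 = 8568" "bin 18 6 = 18564" "bin 18 7 = 31824" "bin 18 8 = 43758" "bin 18 9 = 48620" "bin 18 10 = 43758"
  "bin 19 2 = 171" "bin 19 3 = 969" "bin 19 4 = 3876" "bin 19 5 = 11628" "bin 19 6 = 27132" "bin 19 7 = 50388" "bin 19 8 = 75582" "bin 19 9 = 92378" "bin 19 10 = 92378"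
  "bin 20 2 = 190" "bin 20 3 = 1140" "bin 20 4 = 4845" "bin 20 5 = 15504" "bin 20 6 = 38760" "bin 20 7 = 77520" "bin 20 8 = 125970" "bin 20 9 = 167960" "bin 20 10 = 184756"
  "bin 21 2 = 210" "bin 21 3 = 1330" "bin 21 4 = 5985" "bin 21 5 = 20349" "bin 21 6 = 54264" "bin 21 7 = 116280" "bin 21 8 = 203490" "bin 21 9 = 293930" "bin 21 10 = 352716"
  "bin 22 2 = 231" "bin 22 3 = 1540" "bin 22 4 = 7315" "bin 22 5 = 26334" "bin 22 6 = 74613" "bin 22 7 = 170544" "bin 22 8 = 319770" "bin 22 9 = 497420" "bin 22 10 = 646646"
  "bin 23 2 = 253" "bin 23 3 = 1771" "bin 23 4 = 8855" "bin 23 5 = 33649" "bin 23 6 = 100947" "bin 23 7 = 245157" "bin 23 8 = 490314" "bin 23 9 = 817190" "bin 23 10 = 1144066"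
  "bin 24 2 = 276" "bin 24 3 = 2024" "bin 24 4 = 10626" "bin 24 5 = 42504" "bin 24 6 = 134596" "bin 24 7 = 346104" "bin 24 8 = 735471" "bin 24 9 = 1307504" "bin 24 10 = 1961256"
  "bin 25 2 = 300" "bin 25 3 = 2300" "bin 25 4 = 12650" "bin 25 5 = 53130" "bin 25 6 = 177100" "bin 25 7 = 480700" "bin 25 8 = 1081575" "bin 25 9 = 2042975" "bin 25 10 = 3268760"
  "bin 26 2 = 325" "bin 26 3 = 2600" "bin 26 4 = 14950" "bin 26 5 = 65780" "bin 26 6 = 230230" "bin 26 7 = 657800" "bin 26 8 = 1562275" "bin 26 9 = 3124550" "bin 26 10 = 5311735"
  by (simp_all add: bin_def binomial_code fold_atLeastAtMost_nat.simps fact_numeral)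

lemma bin_simps:
  "bin 0 (numeral m) = 0" "bin (- numeral r) (numeral m) = 0" "bin (numeral r) Numeral1 = numeral r"
  by (simp_all add: bin_def binomial_eq_0)

lemma leaf_simps: "leaf 0 = Zero" "leaf (numeral v) = Leaf (numeral v)" "leaf (- numeral v) = Leaf (- numeral v)"
  by (simp_all add: leaf_def)

lemma funpow_numeral:
  "(f ^^ 0) x = x" "(f ^^ numeral k) x = f ((f ^^ pred_numeral k) x)"
  by (simp_all add: numeral_eq_Suc)

text \<open>As congruence rules these stop the simplifier from descending into tries that are already evaluated.\<close>

lemma node_cong: "Leaf v = Leaf v" "Row e l r = Row e l r" "Col e l r = Col e l r"
  by (rule refl)+

text \<open>The numeral arithmetic in \<open>arith_simps\<close> needs \<open>Numeral1\<close> instead of \<open>1\<close>.\<close>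

lemmas trie_eval = row_node.simps col_node.simps neg.simps sub.simps scale.simps wedge_col.simps wedge_row.simps step_def
  full.simps finish.simps weight.simps unit_row.simps unit_col.simps leaf_simps bin_simps bin_table
  funpow_numeral pred_numeral_simps BitM.simps of_nat_numeral arith_simps mult_zero_left minus_zero
  add_0_left add_0_right diff_0_right diff_0 minus_minus numeral_One[symmetric]

text \<open>\<open>u\<close> and \<open>v\<close> act as Bezout coefficients, so a common prime
  factor of \<open>c\<close> and \<open>d\<close> is 2 or 3.\<close>

lemma prime_dvd_two_three:
  fixes p :: nat
  assumes "prime p" "int p dvd c" "int p dvd d" "u * c + v * d = 2 ^ i * 3 ^ j"
  shows "p \<le> 3" and "i + j \<noteq> 0"
proof -
  have "int p dvd u * c + v * d"
    using assms(2,3) by simp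
  then have dvd: "int p dvd 2 ^ i * 3 ^ j"
    by (simp only: assms(4))
  then have "int p dvd 2 \<or> int p dvd 3"
    using assms(1) by (metis prime_nat_int_transfer prime_dvd_mult_iff prime_dvd_power)
  then show "p \<le> 3"
    by (auto dest: zdvd_imp_le)
  show "i + j \<noteq> 0"
  proof
    assume "i + j = 0"
    then have "int p dvd 1"
      using dvd by simp
    then show False
      using assms(1) by (simp add: prime_nat_iff)
  qed
qed

lemma ordering_exists_eval:
  assumes "prime p" "A \<subseteq> carrier (Z_mod p) - {\<zero>\<^bsub>Z_mod p\<^esub>}" "card A = Suc (Suc t)"
    and "(\<Oplus>\<^bsub>Z_mod p\<^esub>x\<in>A. x) \<noteq> \<zero>\<^bsub>Z_mod p\<^esub>"
    and eval: "finish ((step False ^^ t) (unit_row E (unit_col E))) = (c, d)" "c \<noteq> 0"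
    and E: "length E = Suc t" "distinct E" "\<forall>l\<in>set E. 2 \<le> l \<and> l \<le> t + 2"
    and comb: "u * c + v * d = 2 ^ i * 3 ^ j" "i + j = 0 \<or> 2 \<le> t"
  shows "\<exists>a. is_ordering (Suc (Suc t)) a A \<and>
    (\<forall>i j. 0 \<le> i \<and> i < j \<and> j \<le> Suc (Suc t) \<longrightarrow> partial_sum (Z_mod p) a i \<noteq> partial_sum (Z_mod p) a j)"
proof (rule ordering_exists[OF assms(1-4) E(1)])
  show "\<forall>l\<in>set E. 2 \<le> l \<and> l \<le> Suc t + 1"
    using E(3) by simp
  have pos: "\<forall>l\<in>set E. 0 < l"
    using E(3) by fastforce
  note coeffs = finish[OF represents_funpow[OF E(2) pos] E(2) pos eval]
  have "A \<subseteq> {1..<int p}"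
    using assms(2) by (auto simp: residue_ring_def)
  \<comment> \<open>There are only \<open>p - 1\<close> nonzero residues. For
    \<open>2 \<le> t\<close> this excludes the primes 2 and 3.\<close>
  from card_mono[OF _ this] have "t + 2 < p"
    using assms(3) by auto
  show "\<not> (int p dvd laplace_coeff (Suc t) E E \<and> (0 < Suc t \<longrightarrow> int p dvd laplace_coeff_last (Suc t - 1) E E))"
  proof
    assume "int p dvd laplace_coeff (Suc t) E E \<and> (0 < Suc t \<longrightarrow> int p dvd laplace_coeff_last (Suc t - 1) E E)"
    then have "int p dvd c" "int p dvd d"
      by (simp_all add: coeffs del: laplace_coeff.simps)
    from prime_dvd_two_three[OF assms(1) this comb(1)] \<open>t + 2 < p\<close> comb(2) show False
      by auto
  qed
qed

section \<open>The two coefficients for one to nine variables\<close>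

lemma finish_1:
  "finish ((step False ^^ 0) (unit_row [2] (unit_col [2]))) = (Numeral1, Numeral1)"
  by (simp only: trie_eval cong: node_cong)

lemma finish_2:
  "finish ((step False ^^ Numeral1) (unit_row [2, 3] (unit_col [2, 3]))) = (- Numeral1, 0)"
  by (simp only: trie_eval cong: node_cong)

lemma finish_3:
  "finish ((step False ^^ 2) (unit_row [2, 3, 4] (unit_col [2, 3, 4]))) = (Numeral1, Numeral1)"
  by (simp only: trie_eval cong: node_cong)

lemma finish_4:
  "finish ((step False ^^ 3) (unit_row [2, 3, 4, 5] (unit_col [2, 3, 4, 5]))) = (4, 2)"
  by (simp only: trie_eval cong: node_cong)

lemma finish_5:
  "finish ((step False ^^ 4) (unit_row [2, 3, 4, 5, 6] (unit_col [2, 3, 4, 5, 6]))) = (-28, 40)"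
  by (simp only: trie_eval cong: node_cong)

lemma finish_6:
  "finish ((step False ^^ 5) (unit_row [2, 3, 4, 5, 6, 7] (unit_col [2, 3, 4, 5, 6, 7]))) = (966, -1662)"
  by (simp only: trie_eval cong: node_cong)

lemma finish_7:
  "finish ((step False ^^ 6) (unit_row [2, 3, 4, 5, 6, 7, 8] (unit_col [2, 3, 4, 5, 6, 7, 8]))) = (-366468, 92412)"
  by (simp only: trie_eval cong: node_cong)

lemma finish_8:
  "finish ((step False ^^ 7) (unit_row [2, 3, 4, 5, 6, 7, 8, 9] (unit_col [2, 3, 4, 5, 6, 7, 8, 9]))) = (-359616276, 130597656)"
  by (simp only: trie_eval cong: node_cong)

lemma finish_9:
  "finish ((step False ^^ 8) (unit_row [2, 3, 4, 5, 6, 7, 8, 9, 10] (unit_col [2, 3, 4, 5, 6, 7, 8, 9, 10]))) = (595372941856, -1404671795722)"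
  by (simp only: trie_eval cong: node_cong)

theorem theorem2p2:
  fixes p k :: nat and A :: "int set"
  assumes "prime p"
    and "A \<subseteq> carrier (Z_mod p) - {\<zero>\<^bsub>Z_mod p\<^esub>}"
    and "card A = k" and "k \<le> 10"
    and "(\<Oplus>\<^bsub>Z_mod p\<^esub>x\<in>A. x) \<noteq> \<zero>\<^bsub>Z_mod p\<^esub>"
  shows "\<exists>a. is_ordering k a A \<and>
    (\<forall>i j. 0 \<le> i \<and> i < j \<and> j \<le> k \<longrightarrow> partial_sum (Z_mod p) a i \<noteq> partial_sum (Z_mod p) a j)"
proof -
  have fin: "finite A"
    using assms(2) by (rule finite_subset) (simp add: residue_ring_def)
  have "k \<noteq> 0"
  proof
    assume "k = 0"
    then have "A = {}"
      using fin assms(3) by simp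
    \<comment> \<open>The empty sum is zero, contrary to the assumption.\<close>
    then show False
      using assms(5) finsum_residue[OF assms(1), of "{}" "\<lambda>x. x"] by (simp add: residue_ring_def)
  qed
  then have "k = 1 \<or> k = 2 \<or> k = 3 \<or> k = 4 \<or> k = 5 \<or> k = 6 \<or> k = 7 \<or> k = 8 \<or> k = 9 \<or> k = 10"
    using assms(4) by arith
  then consider "k = 1" | "k = 2" | "k = 3" | "k = 4" | "k = 5" | "k = 6" | "k = 7" | "k = 8" | "k = 9" | "k = 10"
    by blast
  then show ?thesis
  proof cases
    case 1
    then have "card A = Suc 0"
      using assms(3) by simp
    \<comment> \<open>Without variables the coefficient is 1, which no prime divides.\<close>
    from ordering_exists[OF assms(1,2) this assms(5), of "[]"] prime_gt_1_nat[OF assms(1)] show ?thesis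
      by (simp add: 1)
  next
    case 2
    then have "card A = Suc (Suc 0)"
      using assms(3) by simp
    \<comment> \<open>Here and below \<open>2 ^ i * 3 ^ j\<close> is the greatest common divisor of
      the two coefficients, with Bezout coefficients \<open>u\<close> and \<open>v\<close>.\<close>
    from ordering_exists_eval[OF assms(1,2) this assms(5) finish_1, where u = "1" and v = "0" and i = 0 and j = 0]
    show ?thesis
      by (simp add: 2 numeral_2_eq_2)
  next
    case 3
    then have "card A = Suc (Suc Numeral1)"
      using assms(3) by simp
    from ordering_exists_eval[OF assms(1,2) this assms(5) finish_2, where u = "-1" and v = "0" and i = 0 and j = 0]
    show ?thesis
      by (simp add: 3 numeral_3_eq_3)
  next
    case 4
    then have "card A = Suc (Suc 2)"
      using assms(3) by simp
    from ordering_exists_eval[OF assms(1,2) this assms(5) finish_3, where u = "1" and v = "0" and i = 0 and j = 0]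
    show ?thesis
      by (simp add: 4)
  next
    case 5
    then have "card A = Suc (Suc 3)"
      using assms(3) by simp
    from ordering_exists_eval[OF assms(1,2) this assms(5) finish_4, where u = "0" and v = "1" and i = 1 and j = 0]
    show ?thesis
      by (simp add: 5)
  next
    case 6
    then have "card A = Suc (Suc 4)"
      using assms(3) by simp
    from ordering_exists_eval[OF assms(1,2) this assms(5) finish_5, where u = "-3" and v = "-2" and i = 2 and j = 0]
    show ?thesis
      by (simp add: 6)
  next
    case 7
    then have "card A = Suc (Suc 5)"
      using assms(3) by simp
    \<comment> \<open>Neither coefficient suffices alone: 23 divides 966 and 277 divides
      1662.\<close>
    from ordering_exists_eval[OF assms(1,2) this assms(5) finish_6, where u = "117" and v = "68" and i = 1 and j = 1]
    show ?thesis
      by (simp add: 7)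
  next
    case 8
    then have "card A = Suc (Suc 6)"
      using assms(3) by simp
    from ordering_exists_eval[OF assms(1,2) this assms(5) finish_7, where u = "-3371" and v = "-13368" and i = 2 and j = 1]
    show ?thesis
      by (simp add: 8)
  next
    case 9
    then have "card A = Suc (Suc 7)"
      using assms(3) by simp
    from ordering_exists_eval[OF assms(1,2) this assms(5) finish_8, where u = "-4530163" and v = "-12474346" and i = 2 and j = 1]
    show ?thesis
      by (simp add: 9)
  next
    case 10
    then have "card A = Suc (Suc 8)"
      using assms(3) by simp
    from ordering_exists_eval[OF assms(1,2) this assms(5) finish_9, where u = "71044336110" and v = "30112283539" and i = 1 and j = 0]
    show ?thesis
      by (simp add: 10)
  qed
qed

end
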